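(* Let $d\ge 1$ and let $P\subset\mathbb{R}^d$ be a generic orthotope of dimension $d$ with Euler characteristic $\chi(P)$. Define $\sigma(P)=\sum_{v}\sigma(\alpha(v))$, where the sum is over all vertices $v$ of $P$ and $\sigma(\alpha(v))$ is the bouquet sign of the floral vertex $\alpha(v)$ which is the tangent cone of $P$ at $v$. Then $$\chi(P)=2^{-d}\,\sigma(P).$$
   Context: **Series-parallel diagrams.** A series-parallel diagram (SPD) $\Delta$ with finite nonempty edge set $E$ is either a single edge, or a series connection $\Delta_1\wedge\Delta_2$, or a parallel connection $\Delta_1\vee\Delta_2$, of SPDs with disjoint nonempty edge sets whose union is $E$. Thus it is a read-once formula in $\wedge,\vee$ in which each element of $E$ occurs exactly once, considered up to associativity and commutativity of $\wedge$ and of $\vee$. The single vertex is admitted as an SPD with no edges. A signed SPD is a pair $(\Delta,s)$ with $s:E\to\{\pm1\}$. **Bouquet sign.** With $e(\Delta)$, $v(\Delta)$ the numbers of edges and vertices of the two-terminal graph $\Delta$, put $\rho(\Delta)=e(\Delta)-v(\Delta)+1$ and $\sigma(\Delta)=(-1)^{\rho(\Delta)}$. Equivalently, $\sigma=1$ on a single edge and on the single vertex, $\sigma(\Delta_1\wedge\Delta_2)=\sigma(\Delta_1)\sigma(\Delta_2)$, $\sigma(\Delta_1\vee\Delta_2)=-\sigma(\Delta_1)\sigma(\Delta_2)$. **Floral arrangements.** Let $H_i=\{x\in\mathbb{R}^d: x_i\ge 0\}$. If $(\Delta,s)$ is a signed SPD with edge set $E\subset\{1,\dots,d\}$, the floral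 arrangement in $\mathbb{R}^d$ determined by it is the set obtained by interpreting edge $i$ as $s_iH_i$, series connection as intersection and parallel connection as union (the edgeless SPD gives $\mathbb{R}^d$). It is a floral vertex if $E=\{1,\dots,d\}$. For a floral vertex $\alpha$ determined by $(\Delta,s)$, $\sigma(\alpha):=\sigma(\Delta)$. **Orthogonal polytopes.** An axis-aligned box is a product $\prod_{i=1}^d[a_i,b_i]$, $a_i\le b_i$; it is pure $d$-dimensional if all $a_i<b_i$. A pure $d$-dimensional orthogonal polytope is a finite (possibly empty) union of pure $d$-dimensional boxes. For $s\in\{\pm1\}^d$ the orthant $\Omega_s$ is $\{x: s_ix_i\ge0\ \forall i\}$; a local orthotopal arrangement is a union of orthants. The tangent cone of $P$ at $v\in P$ is the local orthotopal arrangement $\alpha$ such that for some $\delta>0$, $P\cap(v+[-\delta,\delta]^d)=v+(\alpha\cap[-\delta,\delta]^d)$. The genericity region of $v\in P$ is the set of points of $P$ joined to $v$ by a path in $P$ along which every tangent cone is congruent (under signed coordinate permutations) to the one at $v$. Its degree is the smallest dimension of a set of the form $\{x:x_i=\lambda_i\ \forall i\in I\}$ ($I\subset\{1,\dots,d\}$) containing it. A point is singular, or a vertex of $P$, if its genericity region has degree $0$. **Generic orthotope.** A generic orthotope of dimension $d$ is a pure $d$-dimensional orthogonal polytope in $\mathbb{R}^d$ such that the tangent cone at every singular point is a floral vertex in $\mathbb{R}^d$ (on $d$ half-spaces). *)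

theory Defs
  imports "HOL-Analysis.Analysis" "HOL-Homology.Homology"
begin

section \<open>Series-parallel diagrams\<close>

text \<open>
  Diagrams are represented by binary trees. The identification up to associativity and
  commutativity of the two connections is not built into the type: everything derived from a
  diagram below (edges, vertex count, sign, the set it determines) is invariant under it.
\<close>

datatype (spd_edges: 'e) spd =
    SingleVertex
  | Edge 'e
  | Series "'e spd" "'e spd"
  | Parallel "'e spd" "'e spd"

primrec valid_spd :: "'e spd \<Rightarrow> bool" where
  "valid_spd SingleVertex = True"
| "valid_spd (Edge i) = True"
| "valid_spd (Series D1 D2) =
     (valid_spd D1 \<and> valid_spd D2 \<and> spd_edges D1 \<noteq> {} \<and> spd_edges D2 \<noteq> {} \<and>
      spd_edges D1 \<inter> spd_edges D2 = {})"
| "valid_spd (Parallel D1 D2) =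
     (valid_spd D1 \<and> valid_spd D2 \<and> spd_edges D1 \<noteq> {} \<and> spd_edges D2 \<noteq> {} \<and>
      spd_edges D1 \<inter> spd_edges D2 = {})"

text \<open>
  Vertices of the two-terminal graph: a series connection glues one terminal of each part, a
  parallel connection glues both pairs of terminals.
\<close>

primrec spd_num_vertices :: "'e spd \<Rightarrow> int" where
  "spd_num_vertices SingleVertex = 1"
| "spd_num_vertices (Edge i) = 2"
| "spd_num_vertices (Series D1 D2) = spd_num_vertices D1 + spd_num_vertices D2 - 1"
| "spd_num_vertices (Parallel D1 D2) = spd_num_vertices D1 + spd_num_vertices D2 - 2"

definition spd_rho :: "'e spd \<Rightarrow> int" where
  "spd_rho D = int (card (spd_edges D)) - spd_num_vertices D + 1"

text \<open>The exponent is nonnegative on valid diagrams (see \<open>spd_rho_nonneg\<close>), so \<open>nat\<close> is harmless.\<close>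

definition spd_sign :: "'e spd \<Rightarrow> int" where
  "spd_sign D = (- 1) ^ nat (spd_rho D)"

lemma finite_spd_edges [simp]: "finite (spd_edges D)"
  by (induction D) auto

lemma spd_rho_Series:
  "valid_spd (Series D1 D2) \<Longrightarrow> spd_rho (Series D1 D2) = spd_rho D1 + spd_rho D2"
  by (simp add: spd_rho_def card_Un_disjoint)

lemma spd_rho_Parallel:
  "valid_spd (Parallel D1 D2) \<Longrightarrow> spd_rho (Parallel D1 D2) = spd_rho D1 + spd_rho D2 + 1"
  by (simp add: spd_rho_def card_Un_disjoint)

lemma spd_rho_nonneg: "valid_spd D \<Longrightarrow> 0 \<le> spd_rho D"
proof (induction D)
  case (Series D1 D2)
  then show ?case using spd_rho_Series[of D1 D2] by simp
next
  case (Parallel D1 D2)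
  then show ?case using spd_rho_Parallel[of D1 D2] by simp
qed (simp_all add: spd_rho_def)

lemma spd_sign_SingleVertex: "spd_sign SingleVertex = 1"
  and spd_sign_Edge: "spd_sign (Edge i) = 1"
  by (simp_all add: spd_sign_def spd_rho_def)

lemma spd_sign_Series:
  "valid_spd (Series D1 D2) \<Longrightarrow> spd_sign (Series D1 D2) = spd_sign D1 * spd_sign D2"
  using spd_rho_nonneg[of D1] spd_rho_nonneg[of D2] spd_rho_Series[of D1 D2]
  by (simp add: spd_sign_def nat_add_distrib power_add)

lemma spd_sign_Parallel:
  "valid_spd (Parallel D1 D2) \<Longrightarrow> spd_sign (Parallel D1 D2) = - (spd_sign D1 * spd_sign D2)"
  using spd_rho_nonneg[of D1] spd_rho_nonneg[of D2] spd_rho_Parallel[of D1 D2]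
  by (simp add: spd_sign_def nat_add_distrib power_add)


section \<open>Floral vertices\<close>

definition coord_halfspace :: "'n \<Rightarrow> (real^'n) set" where
  "coord_halfspace i = {x. 0 \<le> x $ i}"

primrec floral_set :: "('n \<Rightarrow> real) \<Rightarrow> 'n spd \<Rightarrow> (real^'n) set" where
  "floral_set s SingleVertex = UNIV"
| "floral_set s (Edge i) = (\<lambda>x. s i *\<^sub>R x) ` coord_halfspace i"
| "floral_set s (Series D1 D2) = floral_set s D1 \<inter> floral_set s D2"
| "floral_set s (Parallel D1 D2) = floral_set s D1 \<union> floral_set s D2"

definition floral_vertex_of :: "('n::finite \<Rightarrow> real) \<Rightarrow> 'n spd \<Rightarrow> (real^'n) set \<Rightarrow> bool" where
  "floral_vertex_of s D \<alpha> \<longleftrightarrow>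
     valid_spd D \<and> spd_edges D = UNIV \<and> range s \<subseteq> {- 1, 1} \<and> \<alpha> = floral_set s D"

definition floral_vertex :: "(real^'n) set \<Rightarrow> bool" where
  "floral_vertex \<alpha> \<longleftrightarrow> (\<exists>s D. floral_vertex_of s D \<alpha>)"

text \<open>
  The sign of the set \<open>\<alpha>\<close> is that of a signed diagram determining it; it does not depend on
  the choice of the diagram.
\<close>

definition floral_sign :: "(real^'n) set \<Rightarrow> int" where
  "floral_sign \<alpha> = (THE k. \<exists>s D. floral_vertex_of s D \<alpha> \<and> k = spd_sign D)"


section \<open>Orthogonal polytopes\<close>

definition orthogonal_polytope :: "(real^'n) set \<Rightarrow> bool" where
  "orthogonal_polytope P \<longleftrightarrow>
     (\<exists>\<B>. finite \<B> \<and> (\<forall>B\<in>\<B>. \<exists>a b. (\<forall>i. a $ i < b $ i) \<and> B = cbox a b) \<and> P = \<Union>\<B>)"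

definition orthant :: "('n \<Rightarrow> real) \<Rightarrow> (real^'n) set" where
  "orthant s = {x. \<forall>i. 0 \<le> s i * x $ i}"

definition local_arrangement :: "(real^'n) set \<Rightarrow> bool" where
  "local_arrangement \<alpha> \<longleftrightarrow> (\<exists>S. (\<forall>s\<in>S. range s \<subseteq> {- 1, 1}) \<and> \<alpha> = (\<Union>s\<in>S. orthant s))"

definition cube :: "real \<Rightarrow> (real^'n) set" where
  "cube \<delta> = cbox (\<chi> i. - \<delta>) (\<chi> i. \<delta>)"

definition is_tangent_cone :: "(real^'n) set \<Rightarrow> real^'n \<Rightarrow> (real^'n) set \<Rightarrow> bool" where
  "is_tangent_cone P v \<alpha> \<longleftrightarrow>
     local_arrangement \<alpha> \<and>
     (\<exists>\<delta>>0. P \<inter> (\<lambda>x. v + x) ` cube \<delta> = (\<lambda>x. v + x) ` (\<alpha> \<inter> cube \<delta>))"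

definition tangent_cone :: "(real^'n) set \<Rightarrow> real^'n \<Rightarrow> (real^'n) set" where
  "tangent_cone P v = (THE \<alpha>. is_tangent_cone P v \<alpha>)"

definition congruent_arrangements :: "(real^'n) set \<Rightarrow> (real^'n) set \<Rightarrow> bool" where
  "congruent_arrangements \<alpha> \<beta> \<longleftrightarrow>
     (\<exists>\<pi> s. bij \<pi> \<and> range s \<subseteq> {- 1, 1} \<and> \<beta> = (\<lambda>x. \<chi> i. s i * x $ \<pi> i) ` \<alpha>)"

definition genericity_region :: "(real^'n) set \<Rightarrow> real^'n \<Rightarrow> (real^'n) set" where
  "genericity_region P v =
     path_component_set
       {x \<in> P. congruent_arrangements (tangent_cone P v) (tangent_cone P x)} v"

definition coord_flat :: "'n set \<Rightarrow> ('n \<Rightarrow> real) \<Rightarrow> (real^'n) set" where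
  "coord_flat I c = {x. \<forall>i\<in>I. x $ i = c i}"

definition region_degree :: "(real^'n) set \<Rightarrow> nat" where
  "region_degree R = (LEAST k. \<exists>I c. R \<subseteq> coord_flat I c \<and> aff_dim (coord_flat I c) = int k)"

definition orthotope_vertices :: "(real^'n) set \<Rightarrow> (real^'n) set" where
  "orthotope_vertices P = {v \<in> P. region_degree (genericity_region P v) = 0}"

definition generic_orthotope :: "(real^'n) set \<Rightarrow> bool" where
  "generic_orthotope P \<longleftrightarrow>
     orthogonal_polytope P \<and> (\<forall>v\<in>orthotope_vertices P. floral_vertex (tangent_cone P v))"

definition orthotope_sign :: "(real^'n) set \<Rightarrow> int" where
  "orthotope_sign P = (\<Sum>v\<in>orthotope_vertices P. floral_sign (tangent_cone P v))"


section \<open>Euler characteristic\<close>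

text \<open>Linear independence over the integers in a (multiplicatively written) abelian group.\<close>

definition int_independent :: "('a, 'b) monoid_scheme \<Rightarrow> 'a set \<Rightarrow> bool" where
  "int_independent G B \<longleftrightarrow>
     B \<subseteq> carrier G \<and>
     (\<forall>c :: 'a \<Rightarrow> int. finprod G (\<lambda>b. b [^]\<^bsub>G\<^esub> c b) B = \<one>\<^bsub>G\<^esub> \<longrightarrow> (\<forall>b\<in>B. c b = 0))"

text \<open>The torsion-free rank; meaningful when the sizes of independent finite sets are bounded.\<close>

definition abelian_rank :: "('a, 'b) monoid_scheme \<Rightarrow> nat" where
  "abelian_rank G = Sup (card ` {B. finite B \<and> int_independent G B})"

definition betti_number :: "nat \<Rightarrow> 'a topology \<Rightarrow> nat" where
  "betti_number p X = abelian_rank (homology_group (int p) X)"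

text \<open>
  Alternating sum of Betti numbers in integral singular homology; meaningful for spaces with
  finitely generated total homology, such as compact polyhedra.
\<close>

definition euler_characteristic :: "'a topology \<Rightarrow> int" where
  "euler_characteristic X =
     (\<Sum>p | betti_number p X \<noteq> 0. (- 1) ^ p * int (betti_number p X))"

end

theory Submission
  imports Defs
begin

text \<open>
  Weight a sign vector \<open>u \<in> {-1, 0, 1}\<^sup>n\<close> by \<open>2\<close> for every zero and \<open>-1\<close> for every nonzero entry, and
  let the weight of a tangent cone be the sum over the sign vectors it contains. The open cell of
  a grid complex through \<open>u\<close> has \<open>2\<^sup>k\<close> corners, where \<open>k\<close> is the number of nonzero entries, so
  summing the weights of the tangent cones over all grid points counts every \<open>k\<close>-dimensional open
  cell with weight \<open>2\<^sup>n (-1)\<^sup>k\<close> and gives \<open>2\<^sup>n\<close> times the Euler characteristic. Formally both sides are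
  valuations on unions of boxes: for singular homology this follows from excision after replacing
  the closed boxes by slightly larger open ones. The weight of a cone that is invariant under
  translation along some axis vanishes, and those are exactly the tangent cones at points that are
  not vertices; on floral vertices the weight obeys the recursion of the bouquet sign.
\<close>

section \<open>Ranks of abelian groups\<close>

text \<open>The boxes of a decomposition overlap, and their intersections may be degenerate or
  empty. The induction therefore runs over pairs of corners, for which a weight makes sense in all
  cases: a degenerate interval gives a one-point cone of weight 2, the same total as the two ends of
  a proper interval, and corners in the wrong order give the empty cone. On the topological side
  thickening must not make disjoint boxes meet, so its width is bounded by the gaps between grid
  values. Betti numbers are suprema of sizes of independent sets and add along exact sequences only
  where these sizes are bounded, so finiteness is carried through the induction. Vertices are
  defined by path components of points with congruent cones, whereas the weight argument sees only
  free axes. The two notions meet because a point with a free axis can move along it inside its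
  genericity region, while around a point without one all other nearby cones have a free
  axis.\<close>

lemma int_linear_relation:
  fixes a :: "'b \<Rightarrow> 'a \<Rightarrow> int"
  assumes "finite X" "finite Z" "card X < card Z"
  shows "\<exists>c. (\<exists>z\<in>Z. c z \<noteq> 0) \<and> (\<forall>x\<in>X. (\<Sum>z\<in>Z. c z * a z x) = 0)"
  using assms
proof (induction X arbitrary: Z a rule: finite_induct)
  case empty
  then have "Z \<noteq> {}" by auto
  then show ?case by (intro exI[of _ "\<lambda>_. 1"]) auto
next
  case (insert x X)
  show ?case
  proof (cases "\<forall>z\<in>Z. a z x = 0")
    case True
    obtain c where c: "\<exists>z\<in>Z. c z \<noteq> 0" "\<forall>x\<in>X. (\<Sum>z\<in>Z. c z * a z x) = 0"
      using insert.IH[of Z a] insert.prems insert.hyps by auto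
    then show ?thesis using True by (intro exI[of _ c]) auto
  next
    case False
    then obtain z0 where z0: "z0 \<in> Z" "a z0 x \<noteq> 0" by auto
    \<comment> \<open>Fraction-free elimination of equation \<open>x\<close> with pivot
      \<open>a z0 x\<close>: cross-multiplying instead of dividing keeps the coefficients
      integral.\<close>
    define a' where "a' z y = a z0 x * a z y - a z x * a z0 y" for z y
    have "card X < card (Z - {z0})"
      using insert.prems insert.hyps z0 by auto
    then obtain c where c: "\<exists>z\<in>Z - {z0}. c z \<noteq> 0" "\<forall>x\<in>X. (\<Sum>z\<in>Z - {z0}. c z * a' z x) = 0"
      using insert.IH[of "Z - {z0}" a'] insert.prems by auto
    define s where "s = (\<Sum>z\<in>Z - {z0}. c z * a z x)"
    \<comment> \<open>After scaling the reduced solution by the pivot, the value \<open>- s\<close>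
      at \<open>z0\<close> solves equation \<open>x\<close>; the pivot is nonzero, so nontriviality
      survives.\<close>
    define c' where "c' z = (if z = z0 then - s else a z0 x * c z)" for z
    have split: "(\<Sum>z\<in>Z. c' z * a z y) = - s * a z0 y + a z0 x * (\<Sum>z\<in>Z - {z0}. c z * a z y)" for y
    proof -
      have "(\<Sum>z\<in>Z. c' z * a z y) = c' z0 * a z0 y + (\<Sum>z\<in>Z - {z0}. c' z * a z y)"
        using insert.prems z0 by (simp add: sum.remove)
      also have "(\<Sum>z\<in>Z - {z0}. c' z * a z y) = a z0 x * (\<Sum>z\<in>Z - {z0}. c z * a z y)"
        by (auto simp: c'_def sum_distrib_left intro!: sum.cong)
      finally show ?thesis by (simp add: c'_def)
    qed
    have "(\<Sum>z\<in>Z. c' z * a z y) = 0" if "y \<in> insert x X" for y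
    proof (cases "y = x")
      case True
      then show ?thesis unfolding split by (simp add: s_def)
    next
      case False
      then have "(\<Sum>z\<in>Z - {z0}. c z * a' z y) = 0" using c that by auto
      moreover have "(\<Sum>z\<in>Z - {z0}. c z * a' z y)
        = a z0 x * (\<Sum>z\<in>Z - {z0}. c z * a z y) - s * a z0 y"
        by (simp add: a'_def s_def sum_distrib_left sum_distrib_right sum_subtractf algebra_simps)
      ultimately show ?thesis unfolding split by simp
    qed
    moreover have "\<exists>z\<in>Z. c' z \<noteq> 0"
      using c z0 by (auto simp: c'_def)
    ultimately show ?thesis by blast
  qed
qed

section \<open>Integral combinations in an abelian group\<close>

definition int_comb :: "('a, 'b) monoid_scheme \<Rightarrow> ('i \<Rightarrow> 'a) \<Rightarrow> ('i \<Rightarrow> int) \<Rightarrow> 'i set \<Rightarrow> 'a" where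
  "int_comb G e c I = finprod G (\<lambda>i. e i [^]\<^bsub>G\<^esub> c i) I"

lemma int_independent_alt:
  "int_independent G B \<longleftrightarrow> B \<subseteq> carrier G \<and>
     (\<forall>c. int_comb G (\<lambda>b. b) c B = \<one>\<^bsub>G\<^esub> \<longrightarrow> (\<forall>b\<in>B. c b = 0))"
  by (simp add: int_independent_def int_comb_def)

context comm_group
begin

lemma int_comb_closed [simp]: "e \<in> I \<rightarrow> carrier G \<Longrightarrow> int_comb G e c I \<in> carrier G"
  by (auto simp: int_comb_def Pi_iff)

lemma int_comb_id_closed [simp]: "B \<subseteq> carrier G \<Longrightarrow> int_comb G (\<lambda>b. b) c B \<in> carrier G"
  by (rule int_comb_closed) auto

lemma int_comb_insert:
  "\<lbrakk>finite I; i \<notin> I; e \<in> insert i I \<rightarrow> carrier G\<rbrakk>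
    \<Longrightarrow> int_comb G e c (insert i I) = e i [^] c i \<otimes> int_comb G e c I"
  unfolding int_comb_def by (subst finprod_insert) (auto simp: Pi_iff)

lemma int_comb_cong:
  "\<lbrakk>e \<in> I \<rightarrow> carrier G; \<And>i. i \<in> I \<Longrightarrow> e i = e' i; \<And>i. i \<in> I \<Longrightarrow> c i = c' i\<rbrakk>
    \<Longrightarrow> int_comb G e c I = int_comb G e' c' I"
  unfolding int_comb_def by (rule finprod_cong) (auto simp: simp_implies_def Pi_iff)

lemma int_comb_zero: "\<forall>i\<in>I. c i = 0 \<Longrightarrow> int_comb G e c I = \<one>"
  unfolding int_comb_def by (rule finprod_one_eqI) simp

lemma int_comb_add:
  "e \<in> I \<rightarrow> carrier G \<Longrightarrow> int_comb G e (\<lambda>i. c i + c' i) I = int_comb G e c I \<otimes> int_comb G e c' I"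
  unfolding int_comb_def
  by (rule trans[OF finprod_cong finprod_multf]) (auto simp: simp_implies_def Pi_iff int_pow_mult)

lemma int_comb_scale:
  "\<lbrakk>finite I; e \<in> I \<rightarrow> carrier G\<rbrakk> \<Longrightarrow> int_comb G e (\<lambda>i. c i * m) I = int_comb G e c I [^] m"
proof (induction I rule: finite_induct)
  case empty
  then show ?case by (simp add: int_comb_def)
next
  case (insert i I)
  then show ?case
    by (simp add: int_comb_insert int_pow_distrib int_pow_pow Pi_iff)
qed

lemma int_comb_single:
  "\<lbrakk>finite I; j \<in> I; e \<in> I \<rightarrow> carrier G\<rbrakk>
    \<Longrightarrow> int_comb G e (\<lambda>i. if i = j then 1 else 0) I = e j"
proof -
  assume A: "finite I" "j \<in> I" "e \<in> I \<rightarrow> carrier G"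
  have "int_comb G e (\<lambda>i. if i = j then 1 else 0) (insert j (I - {j}))
      = e j [^] (1::int) \<otimes> int_comb G e (\<lambda>i. if i = j then 1 else 0) (I - {j})"
    using A by (subst int_comb_insert) auto
  also have "int_comb G e (\<lambda>i. if i = j then 1 else 0) (I - {j}) = \<one>"
    by (rule int_comb_zero) auto
  finally show ?thesis using A by (simp add: insert_absorb Pi_iff)
qed

lemma int_comb_Un:
  "\<lbrakk>finite I; finite J; I \<inter> J = {}; e \<in> I \<union> J \<rightarrow> carrier G\<rbrakk>
    \<Longrightarrow> int_comb G e c (I \<union> J) = int_comb G e c I \<otimes> int_comb G e c J"
  unfolding int_comb_def by (rule finprod_Un_disjoint) (auto simp: Pi_iff)

text \<open>Substitution multiplies coefficient matrices, so a linear relation between the rows of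
  \<open>a\<close> becomes a relation in the group. Families rather than sets are used because
  different \<open>z\<close> may yield the same element.\<close>

lemma int_comb_int_comb:
  assumes "finite Z" "finite X" "e \<in> X \<rightarrow> carrier G"
  shows "int_comb G (\<lambda>z. int_comb G e (a z) X) c Z = int_comb G e (\<lambda>x. \<Sum>z\<in>Z. c z * a z x) X"
  using assms(1)
proof (induction Z rule: finite_induct)
  case empty
  then show ?case by (simp add: int_comb_zero)
next
  case (insert z Z)
  then show ?case
    using assms by (simp add: int_comb_insert int_comb_scale[symmetric] int_comb_add mult.commute)
qed

lemma int_comb_hom:
  assumes "comm_group H" "f \<in> hom G H" "finite I" "e \<in> I \<rightarrow> carrier G"
  shows "f (int_comb G e c I) = int_comb H (\<lambda>i. f (e i)) c I"
proof -
  interpret H: comm_group H by fact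
  interpret group_hom G H f
    using assms(2) is_group H.is_group by (simp add: group_hom_def group_hom_axioms_def)
  show ?thesis using assms(3,4)
  proof (induction I rule: finite_induct)
    case empty
    then show ?case by (simp add: int_comb_def)
  next
    case (insert i I)
    then have *: "e \<in> I \<rightarrow> carrier G" "e i \<in> carrier G" by auto
    have "f (int_comb G e c (insert i I)) = f (e i [^] c i) \<otimes>\<^bsub>H\<^esub> f (int_comb G e c I)"
      using insert * by (simp add: int_comb_insert)
    also have "\<dots> = f (e i) [^]\<^bsub>H\<^esub> c i \<otimes>\<^bsub>H\<^esub> int_comb H (\<lambda>i. f (e i)) c I"
      using insert * by (simp add: hom_int_pow)
    also have "\<dots> = int_comb H (\<lambda>i. f (e i)) c (insert i I)"
      using insert * by (subst H.int_comb_insert) (auto simp: Pi_iff)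
    finally show ?case .
  qed
qed

lemma int_comb_reindex:
  "\<lbrakk>inj_on h I; e \<in> h ` I \<rightarrow> carrier G\<rbrakk>
    \<Longrightarrow> int_comb G e c (h ` I) = int_comb G (\<lambda>i. e (h i)) (\<lambda>i. c (h i)) I"
  unfolding int_comb_def by (rule finprod_reindex) auto

lemma one_notin_int_independent:
  assumes "finite B" "int_independent G B"
  shows "\<one> \<notin> B"
proof
  assume "\<one> \<in> B"
  moreover have "int_comb G (\<lambda>b. b) (\<lambda>i. if i = \<one> then 1 else 0) B = \<one>"
    using assms \<open>\<one> \<in> B\<close> by (subst int_comb_single) (auto simp: int_independent_def)
  ultimately show False
    using assms unfolding int_independent_alt by force
qed

text \<open>Steinitz bound, with only a nonzero multiple of each \<open>z\<close> required in the
  span of \<open>X\<close>. More rows than columns force an integral dependence between the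
  coefficient rows, and weighting it by the \<open>m z\<close> gives a nontrivial relation on
  \<open>Z\<close>.\<close>

lemma int_independent_card_le:
  assumes Z: "finite Z" "int_independent G Z" and X: "finite X" "X \<subseteq> carrier G"
    and span: "\<And>z. z \<in> Z \<Longrightarrow> \<exists>m c. m \<noteq> 0 \<and> z [^] (m::int) = int_comb G (\<lambda>b. b) c X"
  shows "card Z \<le> card X"
proof (rule ccontr)
  assume "\<not> card Z \<le> card X"
  then have lt: "card X < card Z" by simp
  obtain m a where ma: "\<And>z. z \<in> Z \<Longrightarrow> m z \<noteq> 0 \<and> z [^] (m z::int) = int_comb G (\<lambda>b. b) (a z) X"
    using span by metis
  obtain c where c: "\<exists>z\<in>Z. c z \<noteq> 0" "\<forall>x\<in>X. (\<Sum>z\<in>Z. c z * a z x) = 0"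
    using int_linear_relation[OF X(1) Z(1) lt] by blast
  have Zc: "Z \<subseteq> carrier G" using Z by (auto simp: int_independent_def)
  have "int_comb G (\<lambda>b. b) (\<lambda>z. m z * c z) Z = int_comb G (\<lambda>z. int_comb G (\<lambda>b. b) (a z) X) c Z"
    using Zc unfolding int_comb_def[of _ _ _ Z]
    by (intro finprod_cong) (auto simp: simp_implies_def int_pow_pow[symmetric] ma subset_iff)
  also have "\<dots> = \<one>"
    using c X Z by (subst int_comb_int_comb) (auto intro: int_comb_zero)
  finally have "\<forall>z\<in>Z. m z * c z = 0"
    using Z unfolding int_independent_alt by blast
  then show False using ma c by fastforce
qed

end

section \<open>Ranks of subsets of an abelian group\<close>

definition indep_sets :: "('a, 'b) monoid_scheme \<Rightarrow> 'a set \<Rightarrow> 'a set set" where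
  "indep_sets G S = {B. finite B \<and> B \<subseteq> S \<and> int_independent G B}"

text \<open>Measured inside \<open>G\<close>, so that kernels and images have a rank without being
  made into groups of their own.\<close>

definition set_rank :: "('a, 'b) monoid_scheme \<Rightarrow> 'a set \<Rightarrow> nat" where
  "set_rank G S = Sup (card ` indep_sets G S)"

text \<open>A supremum of natural numbers carries information only for a bounded set, so boundedness
  accompanies the ranks below.\<close>

definition finite_rank :: "('a, 'b) monoid_scheme \<Rightarrow> 'a set \<Rightarrow> bool" where
  "finite_rank G S \<longleftrightarrow> bdd_above (card ` indep_sets G S)"

lemma abelian_rank_eq_set_rank: "abelian_rank G = set_rank G (carrier G)"
proof -
  have "{B. finite B \<and> int_independent G B} = indep_sets G (carrier G)"
    by (auto simp: indep_sets_def int_independent_def)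
  then show ?thesis by (simp add: abelian_rank_def set_rank_def)
qed

lemma empty_in_indep_sets: "comm_group G \<Longrightarrow> {} \<in> indep_sets G S"
  by (simp add: indep_sets_def int_independent_def)

lemma indep_sets_mono: "S \<subseteq> T \<Longrightarrow> indep_sets G S \<subseteq> indep_sets G T"
  by (auto simp: indep_sets_def)

lemma finite_rank_mono: "\<lbrakk>S \<subseteq> T; finite_rank G T\<rbrakk> \<Longrightarrow> finite_rank G S"
  unfolding finite_rank_def by (meson bdd_above_mono image_mono indep_sets_mono)

lemma set_rankI:
  assumes "B \<in> indep_sets G S" "card B = n" "\<And>Z. Z \<in> indep_sets G S \<Longrightarrow> card Z \<le> n"
  shows "finite_rank G S" "set_rank G S = n"
  using assms unfolding finite_rank_def set_rank_def
  by (auto intro!: bdd_aboveI2 cSup_eq_maximum)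

lemma card_le_set_rank:
  "\<lbrakk>finite_rank G S; B \<in> indep_sets G S\<rbrakk> \<Longrightarrow> card B \<le> set_rank G S"
  unfolding finite_rank_def set_rank_def by (rule cSup_upper) auto

lemma set_rank_basis:
  assumes "comm_group G" "finite_rank G S"
  obtains B where "B \<in> indep_sets G S" "card B = set_rank G S"
proof -
  have ne: "card ` indep_sets G S \<noteq> {}"
    using empty_in_indep_sets[OF assms(1)] by auto
  have "Sup (card ` indep_sets G S) \<in> card ` indep_sets G S"
    using assms ne unfolding finite_rank_def
    by (metis Max_in Sup_nat_def bdd_above_nat)
  then show thesis using that unfolding set_rank_def by (metis imageE)
qed

text \<open>A maximal independent set spans only up to multiples: adjoining \<open>x\<close> creates
  a relation, and the coefficient of \<open>x\<close> in it is the exponent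
  \<open>m\<close>.\<close>

lemma (in comm_group) maximal_indep_spans:
  assumes "finite_rank G S" "S \<subseteq> carrier G" "B \<in> indep_sets G S" "card B = set_rank G S" "x \<in> S"
  shows "\<exists>m c. m \<noteq> 0 \<and> x [^] (m::int) = int_comb G (\<lambda>b. b) c B"
proof (cases "x \<in> B")
  case True
  have "x [^] (1::int) = int_comb G (\<lambda>b. b) (\<lambda>i. if i = x then 1 else 0) B"
    using assms True by (subst int_comb_single) (auto simp: indep_sets_def)
  then show ?thesis by (metis zero_neq_one)
next
  case False
  have B: "finite B" "B \<subseteq> S" "int_independent G B" using assms by (auto simp: indep_sets_def)
  have xB: "insert x B \<subseteq> carrier G" using assms B by auto
  have "insert x B \<notin> indep_sets G S"
    using card_le_set_rank[OF assms(1), of "insert x B"] assms(4) False B by auto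
  then obtain c where c: "int_comb G (\<lambda>b. b) c (insert x B) = \<one>" "\<exists>b\<in>insert x B. c b \<noteq> 0"
    using assms B xB by (auto simp: indep_sets_def int_independent_alt)
  have eq: "x [^] c x \<otimes> int_comb G (\<lambda>b. b) c B = \<one>"
    using c False B xB by (subst (asm) int_comb_insert) auto
  \<comment> \<open>Otherwise the relation would live on \<open>B\<close> alone, which is
    independent.\<close>
  have "c x \<noteq> 0"
  proof
    assume "c x = 0"
    then have "int_comb G (\<lambda>b. b) c B = \<one>" using eq xB B int_comb_closed[of "\<lambda>b. b" B c] by (simp add: Pi_iff subset_iff)
    then show False using c B \<open>c x = 0\<close> by (auto simp: int_independent_alt)
  qed
  moreover have "x [^] c x = inv (int_comb G (\<lambda>b. b) c B)"
    using eq xB by (intro inv_equality[symmetric]) auto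
  then have "x [^] c x = int_comb G (\<lambda>b. b) (\<lambda>b. c b * (- 1)) B"
    using xB B by (subst int_comb_scale) (auto simp: int_pow_neg)
  ultimately show ?thesis by blast
qed

text \<open>A maximal independent set \<open>X\<close> of the kernel and lifts of one of the image,
  \<open>Y\<close>, together form one of \<open>G\<close>. For independence, \<open>f\<close> kills
  the \<open>X\<close>-part of a relation and thereby isolates the \<open>Y\<close>-part.\<close>

lemma rank_nullity:
  assumes G: "comm_group G" and H: "comm_group H" and f: "f \<in> hom G H"
    and K: "finite_rank G (kernel G H f)" and I: "finite_rank H (f ` carrier G)"
  shows "finite_rank G (carrier G)"
    and "set_rank G (carrier G) = set_rank G (kernel G H f) + set_rank H (f ` carrier G)"
proof -
  interpret G: comm_group G by fact
  interpret H: comm_group H by fact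
  interpret group_hom G H f
    using f G.is_group H.is_group by (simp add: group_hom_def group_hom_axioms_def)
  obtain X where X: "X \<in> indep_sets G (kernel G H f)" "card X = set_rank G (kernel G H f)"
    using set_rank_basis[OF G K] .
  obtain Y where Y: "Y \<in> indep_sets H (f ` carrier G)" "card Y = set_rank H (f ` carrier G)"
    using set_rank_basis[OF H I] .
  have X': "finite X" "X \<subseteq> carrier G" "\<And>x. x \<in> X \<Longrightarrow> f x = \<one>\<^bsub>H\<^esub>" "int_independent G X"
    using X by (auto simp: indep_sets_def kernel_def)
  have Y': "finite Y" "Y \<subseteq> f ` carrier G" "int_independent H Y"
    using Y by (auto simp: indep_sets_def)
  define g where "g = inv_into (carrier G) f"
  have g: "g y \<in> carrier G" "f (g y) = y" if "y \<in> Y" for y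
    using that Y'(2) unfolding g_def by (auto intro: inv_into_into f_inv_into_f)
  have injg: "inj_on g Y" by (metis g(2) inj_onI)
  have YH: "Y \<subseteq> carrier H" using Y'(3) by (auto simp: int_independent_def)
  \<comment> \<open>Elements of \<open>X\<close> go to the identity under \<open>f\<close>, lifts go
    into \<open>Y\<close>, and an independent set never contains the identity.\<close>
  have disj: "X \<inter> g ` Y = {}"
    using H.one_notin_int_independent[OF Y'(1,3)] X'(3) g by force
  have gY: "g ` Y \<subseteq> carrier G" using g by auto
  have f_comb: "f (int_comb G (\<lambda>b. b) c (g ` Y)) = int_comb H (\<lambda>b. b) (\<lambda>y. c (g y)) Y" for c
  proof -
    have "f (int_comb G (\<lambda>b. b) c (g ` Y)) = int_comb H f c (g ` Y)"
      using G.int_comb_hom[OF H f, of "g ` Y" "\<lambda>b. b" c] Y' gY by auto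
    also have "\<dots> = int_comb H (\<lambda>y. f (g y)) (\<lambda>y. c (g y)) Y"
      using injg gY by (intro H.int_comb_reindex) auto
    also have "\<dots> = int_comb H (\<lambda>b. b) (\<lambda>y. c (g y)) Y"
      using g YH by (intro H.int_comb_cong) auto
    finally show ?thesis .
  qed
  have f_comb_X: "f (int_comb G (\<lambda>b. b) c X) = \<one>\<^bsub>H\<^esub>" for c
    using G.int_comb_hom[OF H f X'(1), of "\<lambda>b. b" c] X'(2,3)
    by (auto simp: int_comb_def subset_iff intro!: H.finprod_one_eqI)
  have indep: "X \<union> g ` Y \<in> indep_sets G (carrier G)"
    unfolding indep_sets_def int_independent_alt
  proof (intro CollectI conjI allI impI)
    fix c
    assume c1: "int_comb G (\<lambda>b. b) c (X \<union> g ` Y) = \<one>\<^bsub>G\<^esub>"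
    have c2: "int_comb G (\<lambda>b. b) c X \<otimes>\<^bsub>G\<^esub> int_comb G (\<lambda>b. b) c (g ` Y) = \<one>\<^bsub>G\<^esub>"
      using c1 X' Y' gY disj by (subst (asm) G.int_comb_Un) auto
    have "f (int_comb G (\<lambda>b. b) c X \<otimes>\<^bsub>G\<^esub> int_comb G (\<lambda>b. b) c (g ` Y))
        = int_comb H (\<lambda>b. b) (\<lambda>y. c (g y)) Y"
      using X' gY YH by (subst hom_mult) (auto simp: f_comb f_comb_X subset_iff)
    then have "int_comb H (\<lambda>b. b) (\<lambda>y. c (g y)) Y = \<one>\<^bsub>H\<^esub>" using c2 by simp
    then have cY: "\<forall>y\<in>Y. c (g y) = 0" using Y'(3) by (auto simp: int_independent_alt)
    then have "int_comb G (\<lambda>b. b) c (g ` Y) = \<one>\<^bsub>G\<^esub>" by (intro G.int_comb_zero) auto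
    then have "int_comb G (\<lambda>b. b) c X = \<one>\<^bsub>G\<^esub>" using c2 X' by (simp add: subset_iff)
    then show "\<forall>b\<in>X \<union> g ` Y. c b = 0" using X'(4) cY by (auto simp: int_independent_alt)
  qed (use X' Y' gY in auto)
  have bound: "card Z \<le> card (X \<union> g ` Y)" if Z: "Z \<in> indep_sets G (carrier G)" for Z
  proof (rule G.int_independent_card_le)
    fix z assume "z \<in> Z"
    then have z: "z \<in> carrier G" using Z by (auto simp: indep_sets_def)
    \<comment> \<open>Two multiples are taken: \<open>m\<close> brings \<open>f z\<close> into the
      span of \<open>Y\<close>, and after dividing out the lifted combination, \<open>n\<close>
      brings the remaining kernel element into the span of \<open>X\<close>. Hence the exponent
      \<open>m * n\<close>.\<close>
    obtain m c where m: "m \<noteq> 0" "f z [^]\<^bsub>H\<^esub> (m::int) = int_comb H (\<lambda>b. b) c Y"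
      using H.maximal_indep_spans[OF I _ Y] z by (metis imageI img_is_subgroup subgroup.subset)
    define c' where "c' b = c (f b)" for b
    let ?y = "int_comb G (\<lambda>b. b) c' (g ` Y)"
    have y: "?y \<in> carrier G" using gY by (intro G.int_comb_closed) auto
    have "f ?y = int_comb H (\<lambda>b. b) c Y"
      unfolding f_comb using g YH by (intro H.int_comb_cong) (auto simp: c'_def)
    then have "z [^]\<^bsub>G\<^esub> m \<otimes>\<^bsub>G\<^esub> inv\<^bsub>G\<^esub> ?y \<in> kernel G H f"
      using z y m(2) using hom_closed[OF y] by (simp add: kernel_def hom_int_pow)
    then obtain n d where n: "n \<noteq> 0"
      "(z [^]\<^bsub>G\<^esub> m \<otimes>\<^bsub>G\<^esub> inv\<^bsub>G\<^esub> ?y) [^]\<^bsub>G\<^esub> (n::int) = int_comb G (\<lambda>b. b) d X"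
      using G.maximal_indep_spans[OF K _ X] by (metis subgroup.subset subgroup_kernel)
    have "z [^]\<^bsub>G\<^esub> (m * n) = (z [^]\<^bsub>G\<^esub> m \<otimes>\<^bsub>G\<^esub> inv\<^bsub>G\<^esub> ?y \<otimes>\<^bsub>G\<^esub> ?y) [^]\<^bsub>G\<^esub> n"
      using z y by (simp add: G.int_pow_pow G.m_assoc)
    also have "\<dots> = int_comb G (\<lambda>b. b) d X \<otimes>\<^bsub>G\<^esub> int_comb G (\<lambda>b. b) (\<lambda>b. c' b * n) (g ` Y)"
      using z y n(2) G.int_comb_scale[of "g ` Y" "\<lambda>b. b" c' n] gY Y'(1)
      by (subst G.int_pow_distrib) (auto simp: Pi_iff subset_iff)
    also have "\<dots> = int_comb G (\<lambda>b. b) (\<lambda>b. if b \<in> X then d b else c' b * n) (X \<union> g ` Y)"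
    proof -
      have "int_comb G (\<lambda>b. b) (\<lambda>b. if b \<in> X then d b else c' b * n) X = int_comb G (\<lambda>b. b) d X"
        using X' by (intro G.int_comb_cong) auto
      moreover have "int_comb G (\<lambda>b. b) (\<lambda>b. if b \<in> X then d b else c' b * n) (g ` Y)
          = int_comb G (\<lambda>b. b) (\<lambda>b. c' b * n) (g ` Y)"
        using gY disj by (intro G.int_comb_cong) auto
      ultimately show ?thesis
        using X' Y' gY disj by (subst G.int_comb_Un) auto
    qed
    finally show "\<exists>k c. k \<noteq> 0 \<and> z [^]\<^bsub>G\<^esub> (k::int) = int_comb G (\<lambda>b. b) c (X \<union> g ` Y)"
      using m n by (metis mult_eq_0_iff)
  qed (use Z X' Y' gY in \<open>auto simp: indep_sets_def\<close>)
  have "card (X \<union> g ` Y) = set_rank G (kernel G H f) + set_rank H (f ` carrier G)"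
    using X Y X' Y' disj injg by (simp add: card_Un_disjoint card_image)
  then show "finite_rank G (carrier G)"
    and "set_rank G (carrier G) = set_rank G (kernel G H f) + set_rank H (f ` carrier G)"
    using set_rankI[OF indep _ bound] by auto
qed

text \<open>Lifts of an independent set of the image are independent in \<open>G\<close>, because
  \<open>f\<close> carries any relation between them to one between their images.\<close>

lemma finite_rank_image:
  assumes G: "comm_group G" and H: "comm_group H" and f: "f \<in> hom G H"
    and fin: "finite_rank G (carrier G)"
  shows "finite_rank H (f ` carrier G)"
proof -
  interpret G: comm_group G by fact
  interpret H: comm_group H by fact
  have "card Y \<le> set_rank G (carrier G)" if Y: "Y \<in> indep_sets H (f ` carrier G)" for Y
  proof -
    have Y': "finite Y" "Y \<subseteq> f ` carrier G" "int_independent H Y"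
      using Y by (auto simp: indep_sets_def)
    define g where "g = inv_into (carrier G) f"
    have g: "g y \<in> carrier G" "f (g y) = y" if "y \<in> Y" for y
      using that Y'(2) unfolding g_def by (auto intro: inv_into_into f_inv_into_f)
    have injg: "inj_on g Y" by (metis g(2) inj_onI)
    have YH: "Y \<subseteq> carrier H" using Y'(3) by (auto simp: int_independent_def)
    have gY: "g ` Y \<subseteq> carrier G" using g by auto
    have "g ` Y \<in> indep_sets G (carrier G)"
      unfolding indep_sets_def int_independent_alt
    proof (intro CollectI conjI allI impI)
      fix c
      assume "int_comb G (\<lambda>b. b) c (g ` Y) = \<one>\<^bsub>G\<^esub>"
      then have "f (int_comb G (\<lambda>b. b) c (g ` Y)) = \<one>\<^bsub>H\<^esub>"
        using hom_one[OF f G.is_group H.is_group] by simp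
      moreover have "f (int_comb G (\<lambda>b. b) c (g ` Y)) = int_comb H f c (g ` Y)"
        using G.int_comb_hom[OF H f, of "g ` Y" "\<lambda>b. b" c] Y' gY by auto
      moreover have "int_comb H f c (g ` Y) = int_comb H (\<lambda>y. f (g y)) (\<lambda>y. c (g y)) Y"
        using injg gY f by (intro H.int_comb_reindex) (auto simp: hom_def)
      moreover have "\<dots> = int_comb H (\<lambda>b. b) (\<lambda>y. c (g y)) Y"
        using g YH by (intro H.int_comb_cong) auto
      ultimately show "\<forall>b\<in>g ` Y. c b = 0" using Y'(3) by (auto simp: int_independent_alt)
    qed (use Y' gY in auto)
    then show ?thesis using card_le_set_rank[OF fin] injg by (metis card_image)
  qed
  then show ?thesis unfolding finite_rank_def by (intro bdd_aboveI2)
qed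

lemma set_rank_trivial:
  assumes "comm_group G" "S \<subseteq> {\<one>\<^bsub>G\<^esub>}"
  shows "finite_rank G S" "set_rank G S = 0"
proof -
  have *: "card Z \<le> 0" if "Z \<in> indep_sets G S" for Z
  proof -
    have "\<one>\<^bsub>G\<^esub> \<notin> Z"
      using that comm_group.one_notin_int_independent[OF assms(1)] by (auto simp: indep_sets_def)
    then have "Z = {}" using that assms by (auto simp: indep_sets_def)
    then show ?thesis by simp
  qed
  show "finite_rank G S" "set_rank G S = 0"
    using set_rankI[OF empty_in_indep_sets[OF assms(1)] _ *] by auto
qed

lemma set_rank_iso:
  assumes G: "comm_group G" and H: "comm_group H" and "G \<cong> H" and fin: "finite_rank G (carrier G)"
  shows "finite_rank H (carrier H)" "set_rank H (carrier H) = set_rank G (carrier G)"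
proof -
  obtain f where f: "f \<in> hom G H" "bij_betw f (carrier G) (carrier H)"
    using assms(3) by (auto simp: is_iso_def iso_def)
  have ker: "kernel G H f \<subseteq> {\<one>\<^bsub>G\<^esub>}"
  proof
    fix x assume "x \<in> kernel G H f"
    then have "x \<in> carrier G" "f x = f \<one>\<^bsub>G\<^esub>"
      using hom_one[OF f(1)] G H by (auto simp: kernel_def comm_group_def)
    then show "x \<in> {\<one>\<^bsub>G\<^esub>}"
      using f(2) G by (auto simp: bij_betw_def comm_group_def group.is_monoid monoid.one_closed dest: inj_onD)
  qed
  have im: "f ` carrier G = carrier H" using f by (auto simp: bij_betw_def)
  show "finite_rank H (carrier H)" using finite_rank_image[OF G H f(1) fin] im by simp
  then show "set_rank H (carrier H) = set_rank G (carrier G)"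
    using rank_nullity[OF G H f(1)] set_rank_trivial[OF G ker] im by simp
qed

section \<open>Additivity of the Euler characteristic\<close>

text \<open>Degrees run over \<open>int\<close> because the boundary map leads from degree 0 to
  degree -1. Vanishing is asked only for large degrees, as \<open>graded_euler\<close> sums over the
  natural ones.\<close>

definition finite_type :: "(int \<Rightarrow> ('a, 'b) monoid_scheme) \<Rightarrow> bool" where
  "finite_type A \<longleftrightarrow> (\<forall>p. finite_rank (A p) (carrier (A p))) \<and>
     (\<exists>N. \<forall>p. int N \<le> p \<longrightarrow> set_rank (A p) (carrier (A p)) = 0)"

definition graded_euler :: "(int \<Rightarrow> ('a, 'b) monoid_scheme) \<Rightarrow> int" where
  "graded_euler A =
     (\<Sum>p | abelian_rank (A (int p)) \<noteq> 0. (- 1) ^ p * int (abelian_rank (A (int p))))"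

lemma euler_characteristic_eq_graded:
  "euler_characteristic X = graded_euler (\<lambda>p. homology_group p X)"
  by (simp add: euler_characteristic_def graded_euler_def betti_number_def)

lemma graded_euler_eq_sum:
  assumes "\<And>p. int N \<le> p \<Longrightarrow> set_rank (A p) (carrier (A p)) = 0"
  shows "graded_euler A = (\<Sum>p<N. (- 1) ^ p * int (set_rank (A (int p)) (carrier (A (int p)))))"
proof -
  have "{p. abelian_rank (A (int p)) \<noteq> 0} \<subseteq> {..<N}"
  proof
    fix p assume "p \<in> {p. abelian_rank (A (int p)) \<noteq> 0}"
    then have "\<not> int N \<le> int p" using assms[of "int p"] by (auto simp: abelian_rank_eq_set_rank)
    then show "p \<in> {..<N}" by simp
  qed
  then show ?thesis unfolding graded_euler_def abelian_rank_eq_set_rank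
    by (intro sum.mono_neutral_left) auto
qed

lemma finite_type_iso:
  assumes "\<And>p. comm_group (A p)" "\<And>p. comm_group (B p)" "\<And>p. A p \<cong> B p" "finite_type A"
  shows "finite_type B" "graded_euler B = graded_euler A"
proof -
  have "finite_rank (B p) (carrier (B p))"
       "set_rank (B p) (carrier (B p)) = set_rank (A p) (carrier (A p))" for p
    using set_rank_iso[of "A p" "B p"] assms by (auto simp: finite_type_def)
  then show "finite_type B" "graded_euler B = graded_euler A"
    using assms(4) by (auto simp: finite_type_def graded_euler_def abelian_rank_eq_set_rank)
qed

text \<open>Exactness is kept abstract because only ranks are extracted from it. \<open>neg\<close>
  makes the boundary map out of degree 0 have rank zero, which settles the lower end of the
  telescoping sum.\<close>

locale long_exact_sequence =
  fixes A :: "int \<Rightarrow> ('a, 'u) monoid_scheme" and X :: "int \<Rightarrow> ('b, 'v) monoid_scheme"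
    and R :: "int \<Rightarrow> ('c, 'w) monoid_scheme"
    and i :: "int \<Rightarrow> 'a \<Rightarrow> 'b" and j :: "int \<Rightarrow> 'b \<Rightarrow> 'c" and d :: "int \<Rightarrow> 'c \<Rightarrow> 'a"
  assumes gA: "\<And>p. comm_group (A p)" and gX: "\<And>p. comm_group (X p)" and gR: "\<And>p. comm_group (R p)"
    and i: "\<And>p. i p \<in> hom (A p) (X p)" and j: "\<And>p. j p \<in> hom (X p) (R p)"
    and d: "\<And>p. d p \<in> hom (R p) (A (p - 1))"
    and exX: "\<And>p. kernel (X p) (R p) (j p) = i p ` carrier (A p)"
    and exR: "\<And>p. kernel (R p) (A (p - 1)) (d p) = j p ` carrier (X p)"
    and exA: "\<And>p. kernel (A p) (X p) (i p) = d (p + 1) ` carrier (R (p + 1))"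
    and neg: "trivial_group (A (- 1))"
begin

lemma image_subset:
  "i p ` carrier (A p) \<subseteq> carrier (X p)" "j p ` carrier (X p) \<subseteq> carrier (R p)"
  "d (p + 1) ` carrier (R (p + 1)) \<subseteq> carrier (A p)"
  using i[of p] j[of p] d[of "p + 1"] by (auto simp: hom_def)

lemma rank_d_0: "set_rank (A (- 1)) (d 0 ` carrier (R 0)) = 0"
  using image_subset(3)[of "- 1"] neg
  by (intro set_rank_trivial(2) gA) (auto simp: trivial_group_def)

context
  assumes fin: "\<And>p. finite_rank (A p) (carrier (A p))" "\<And>p. finite_rank (X p) (carrier (X p))"
    "\<And>p. finite_rank (R p) (carrier (R p))"
begin

lemma rank_split:
  "set_rank (A p) (carrier (A p))
     = set_rank (A p) (d (p + 1) ` carrier (R (p + 1))) + set_rank (X p) (i p ` carrier (A p))"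
  "set_rank (X p) (carrier (X p))
     = set_rank (X p) (i p ` carrier (A p)) + set_rank (R p) (j p ` carrier (X p))"
  "set_rank (R p) (carrier (R p))
     = set_rank (R p) (j p ` carrier (X p)) + set_rank (A (p - 1)) (d p ` carrier (R p))"
proof -
  have sub: "d p ` carrier (R p) \<subseteq> carrier (A (p - 1))" using image_subset(3)[of "p - 1"] by simp
  note fins = finite_rank_mono[OF image_subset(1)[of p] fin(2)]
    finite_rank_mono[OF image_subset(2)[of p] fin(3)]
    finite_rank_mono[OF image_subset(3)[of p] fin(1)] finite_rank_mono[OF sub fin(1)]
  show "set_rank (A p) (carrier (A p))
     = set_rank (A p) (d (p + 1) ` carrier (R (p + 1))) + set_rank (X p) (i p ` carrier (A p))"
    using rank_nullity(2)[OF gA gX i[of p]] fins by (simp add: exA)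
  show "set_rank (X p) (carrier (X p))
     = set_rank (X p) (i p ` carrier (A p)) + set_rank (R p) (j p ` carrier (X p))"
    using rank_nullity(2)[OF gX gR j[of p]] fins by (simp add: exX)
  show "set_rank (R p) (carrier (R p))
     = set_rank (R p) (j p ` carrier (X p)) + set_rank (A (p - 1)) (d p ` carrier (R p))"
    using rank_nullity(2)[OF gR gA d[of p]] fins by (simp add: exR)
qed

text \<open>With \<open>D\<close>, \<open>I\<close>, \<open>J\<close> the ranks of the images of
  \<open>d\<close>, \<open>i\<close>, \<open>j\<close>, the ranks of \<open>A\<close>,
  \<open>X\<close>, \<open>R\<close> in degree \<open>p\<close> are \<open>D (Suc p) + I p\<close>,
  \<open>I p + J p\<close>, \<open>J p + D p\<close>. In the alternating sum \<open>I\<close> and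
  \<open>J\<close> cancel and \<open>D\<close> telescopes.\<close>

lemma graded_euler_additive_aux:
  assumes N: "\<And>p. int N \<le> p \<Longrightarrow> set_rank (A p) (carrier (A p)) = 0"
    "\<And>p. int N \<le> p \<Longrightarrow> set_rank (X p) (carrier (X p)) = 0"
    "\<And>p. int N \<le> p \<Longrightarrow> set_rank (R p) (carrier (R p)) = 0"
  shows "graded_euler X = graded_euler A + graded_euler R"
proof -
  define D where "D p = int (set_rank (A (int p - 1)) (d (int p) ` carrier (R (int p))))" for p
  define I where "I p = int (set_rank (X (int p)) (i (int p) ` carrier (A (int p))))" for p
  define J where "J p = int (set_rank (R (int p)) (j (int p) ` carrier (X (int p))))" for p
  have tele: "(\<Sum>p<n. (- 1) ^ p * (D (Suc p) + D p)) = D 0 - (- 1) ^ n * D n" for n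
    by (induction n) (auto simp: algebra_simps)
  \<comment> \<open>The upper end: \<open>d\<close> starts in degree \<open>N\<close> of
    \<open>R\<close>, where the rank is zero.\<close>
  have DN: "D N = 0" using rank_split(3)[of "int N"] N(3)[of "int N"] by (simp add: D_def)
  have D0: "D 0 = 0" using rank_d_0 by (simp add: D_def)
  have "graded_euler A + graded_euler R - graded_euler X
      = (\<Sum>p<N. (- 1) ^ p * (D (Suc p) + I p)) + (\<Sum>p<N. (- 1) ^ p * (J p + D p))
        - (\<Sum>p<N. (- 1) ^ p * (I p + J p))"
    using graded_euler_eq_sum[of N A] graded_euler_eq_sum[of N X] graded_euler_eq_sum[of N R] N
    by (simp add: rank_split D_def I_def J_def add.commute)
  also have "\<dots> = (\<Sum>p<N. (- 1) ^ p * (D (Suc p) + D p))"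
    by (simp add: sum.distrib[symmetric] sum_subtractf[symmetric] algebra_simps)
  also have "\<dots> = 0" by (simp add: tele DN D0)
  finally show ?thesis by simp
qed

end

text \<open>From absolute to relative homology; \<open>finite_type_total\<close> goes back. The
  union formula uses this one for the pair of \<open>B\<close> and \<open>A \<inter> B\<close>, the
  other for the pair of \<open>A \<union> B\<close> and \<open>A\<close>.\<close>

lemma finite_type_relative:
  assumes A: "finite_type A" and X: "finite_type X"
  shows "finite_type R" "graded_euler X = graded_euler A + graded_euler R"
proof -
  have fA: "finite_rank (A p) (carrier (A p))" and fX: "finite_rank (X p) (carrier (X p))" for p
    using A X by (auto simp: finite_type_def)
  have fR: "finite_rank (R p) (carrier (R p))" for p
  proof (rule rank_nullity(1)[OF gR gA d[of p]])
    show "finite_rank (R p) (kernel (R p) (A (p - 1)) (d p))"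
      unfolding exR by (rule finite_rank_image[OF gX gR j fX])
    show "finite_rank (A (p - 1)) (d p ` carrier (R p))"
      using finite_rank_mono[OF image_subset(3)[of "p - 1"] fA] by simp
  qed
  obtain N1 N2 where N: "\<And>p. int N1 \<le> p \<Longrightarrow> set_rank (A p) (carrier (A p)) = 0"
    "\<And>p. int N2 \<le> p \<Longrightarrow> set_rank (X p) (carrier (X p)) = 0"
    using A X by (auto simp: finite_type_def)
  \<comment> \<open>One degree further than for \<open>A\<close> and \<open>X\<close>: the boundary
    map sends degree \<open>p\<close> of \<open>R\<close> into degree \<open>p - 1\<close> of
    \<open>A\<close>, whose rank must vanish as well.\<close>
  have R0: "set_rank (R p) (carrier (R p)) = 0" if "int (Suc (max N1 N2)) \<le> p" for p
    using rank_split[OF fA fX fR, of p] rank_split(1)[OF fA fX fR, of "p - 1"]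
      N(1)[of p] N(1)[of "p - 1"] N(2)[of p] that by simp
  show "finite_type R"
    using fR R0 by (auto simp: finite_type_def intro!: exI[of _ "Suc (max N1 N2)"])
  show "graded_euler X = graded_euler A + graded_euler R"
    by (rule graded_euler_additive_aux[OF fA fX fR, of "Suc (max N1 N2)"]) (use N R0 in auto)
qed

lemma finite_type_total:
  assumes A: "finite_type A" and R: "finite_type R"
  shows "finite_type X" "graded_euler X = graded_euler A + graded_euler R"
proof -
  have fA: "finite_rank (A p) (carrier (A p))" and fR: "finite_rank (R p) (carrier (R p))" for p
    using A R by (auto simp: finite_type_def)
  have fX: "finite_rank (X p) (carrier (X p))" for p
  proof (rule rank_nullity(1)[OF gX gR j[of p]])
    show "finite_rank (X p) (kernel (X p) (R p) (j p))"
      unfolding exX by (rule finite_rank_image[OF gA gX i fA])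
    show "finite_rank (R p) (j p ` carrier (X p))"
      using finite_rank_mono[OF image_subset(2) fR] by simp
  qed
  obtain N1 N2 where N: "\<And>p. int N1 \<le> p \<Longrightarrow> set_rank (A p) (carrier (A p)) = 0"
    "\<And>p. int N2 \<le> p \<Longrightarrow> set_rank (R p) (carrier (R p)) = 0"
    using A R by (auto simp: finite_type_def)
  have X0: "set_rank (X p) (carrier (X p)) = 0" if "int (max N1 N2) \<le> p" for p
    using rank_split[OF fA fX fR, of p] N(1)[of p] N(2)[of p] that by simp
  show "finite_type X"
    using fX X0 by (auto simp: finite_type_def intro!: exI[of _ "max N1 N2"])
  show "graded_euler X = graded_euler A + graded_euler R"
    by (rule graded_euler_additive_aux[OF fA fX fR, of "max N1 N2"]) (use N X0 in auto)
qed

end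

section \<open>Singular homology and unions of open sets\<close>

abbreviation homology_finite :: "'a topology \<Rightarrow> bool" where
  "homology_finite X \<equiv> finite_type (\<lambda>p. homology_group p X)"

lemma long_exact_sequence_homology:
  "long_exact_sequence (\<lambda>p. homology_group p (subtopology X S)) (\<lambda>p. homology_group p X)
     (\<lambda>p. relative_homology_group p X S)
     (\<lambda>p. hom_induced p (subtopology X S) {} X {} id) (\<lambda>p. hom_induced p X {} X S id)
     (\<lambda>p. hom_boundary p X S)"
proof (rule long_exact_sequence.intro)
  fix p :: int
  show "kernel (homology_group p X) (relative_homology_group p X S) (hom_induced p X {} X S id) =
      hom_induced p (subtopology X S) {} X {} id ` carrier (homology_group p (subtopology X S))"
    using homology_exactness_axiom_3[of p X S] by simp
  show "kernel (relative_homology_group p X S) (homology_group (p - 1) (subtopology X S)) (hom_boundary p X S) =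
      hom_induced p X {} X S id ` carrier (homology_group p X)"
    using homology_exactness_axiom_1[of p X S] by simp
  show "kernel (homology_group p (subtopology X S)) (homology_group p X) (hom_induced p (subtopology X S) {} X {} id) =
      hom_boundary (p + 1) X S ` carrier (relative_homology_group (p + 1) X S)"
    using homology_exactness_axiom_2[of "p + 1" X S] by simp
qed (simp_all add: hom_induced_hom hom_boundary_hom)

text \<open>Excising \<open>A - B\<close> from the pair of \<open>A \<union> B\<close> and
  \<open>A\<close> leaves the pair of \<open>B\<close> and \<open>A \<inter> B\<close>. Both pairs
  have the same relative homology; equating its Euler characteristic computed from either pair gives
  inclusion-exclusion.\<close>

lemma euler_characteristic_open_Un:
  fixes A B :: "'a::topological_space set"
  assumes op: "open A" "open B"
    and A: "homology_finite (top_of_set A)" and B: "homology_finite (top_of_set B)"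
    and AB: "homology_finite (top_of_set (A \<inter> B))"
  shows "homology_finite (top_of_set (A \<union> B))"
    and "euler_characteristic (top_of_set (A \<union> B)) =
      euler_characteristic (top_of_set A) + euler_characteristic (top_of_set B)
      - euler_characteristic (top_of_set (A \<inter> B))"
proof -
  define X where "X = top_of_set (A \<union> B)"
  have subs: "subtopology X A = top_of_set A" "subtopology X B = top_of_set B"
    "subtopology (top_of_set B) (A \<inter> B) = top_of_set (A \<inter> B)"
    "subtopology X (A \<union> B) = X"
    by (simp_all add: X_def subtopology_subtopology Int_absorb1 Int_absorb2 Int_commute inf_sup_aci)
  interpret L1: long_exact_sequence "\<lambda>p. homology_group p (top_of_set A)" "\<lambda>p. homology_group p X"
     "\<lambda>p. relative_homology_group p X A"
     "\<lambda>p. hom_induced p (top_of_set A) {} X {} id" "\<lambda>p. hom_induced p X {} X A id"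
     "\<lambda>p. hom_boundary p X A"
    using long_exact_sequence_homology[of X A] by (simp add: subs)
  interpret L2: long_exact_sequence "\<lambda>p. homology_group p (top_of_set (A \<inter> B))"
     "\<lambda>p. homology_group p (top_of_set B)"
     "\<lambda>p. relative_homology_group p (top_of_set B) (A \<inter> B)"
     "\<lambda>p. hom_induced p (top_of_set (A \<inter> B)) {} (top_of_set B) {} id"
     "\<lambda>p. hom_induced p (top_of_set B) {} (top_of_set B) (A \<inter> B) id"
     "\<lambda>p. hom_boundary p (top_of_set B) (A \<inter> B)"
    using long_exact_sequence_homology[of "top_of_set B" "A \<inter> B"] by (simp only: subs)
  \<comment> \<open>Openness of \<open>B\<close> makes \<open>A - B\<close> closed in the union and
    openness of \<open>A\<close> makes \<open>A\<close> its own interior; together this is the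
    hypothesis of excision.\<close>
  have "closedin X (A - B)"
  proof -
    have "A - B = (A \<union> B) \<inter> (- B)" by auto
    then show ?thesis unfolding X_def using op by (metis closed_Compl closedin_closed_Int)
  qed
  moreover have "openin X A" unfolding X_def using op by (metis Un_upper1 openin_open_eq openin_subset open_openin openin_subtopology_self open_subset)
  ultimately have exc: "X closure_of (A - B) \<subseteq> X interior_of A"
    by (simp add: closure_of_closedin interior_of_openin)
  have eqs: "A \<union> B - (A - B) = B" "A - (A - B) = A \<inter> B" by auto
  have iso: "relative_homology_group p (top_of_set B) (A \<inter> B) \<cong> relative_homology_group p X A" for p
    using homology_excision_axiom[OF exc, of "A \<union> B" p] unfolding eqs subs
    by (auto simp: is_iso_def)
  note R2 = L2.finite_type_relative[OF AB B]
  note R1 = finite_type_iso[OF _ _ iso R2(1)]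
  have R1': "finite_type (\<lambda>p. relative_homology_group p X A)" using R1(1) by simp
  show "homology_finite (top_of_set (A \<union> B))"
    using L1.finite_type_total(1)[OF A R1'] by (simp add: X_def)
  show "euler_characteristic (top_of_set (A \<union> B)) =
      euler_characteristic (top_of_set A) + euler_characteristic (top_of_set B)
      - euler_characteristic (top_of_set (A \<inter> B))"
    using L1.finite_type_total(2)[OF A R1'] R2(2) R1(2)
    by (simp add: X_def euler_characteristic_eq_graded)
qed

lemma euler_characteristic_homotopy_equivalent:
  assumes "X homotopy_equivalent_space Y" "homology_finite X"
  shows "homology_finite Y" "euler_characteristic Y = euler_characteristic X"
  using finite_type_iso[OF _ _ homotopy_equivalent_space_imp_isomorphic_homology_groups[OF assms(1)] assms(2)]
  by (simp_all add: euler_characteristic_eq_graded)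

lemma euler_characteristic_empty:
  assumes "topspace X = {}"
  shows "homology_finite X" "euler_characteristic X = 0"
proof -
  have *: "finite_rank (homology_group p X) (carrier (homology_group p X))"
    "set_rank (homology_group p X) (carrier (homology_group p X)) = 0" for p
    using set_rank_trivial[of "homology_group p X"] trivial_homology_group_empty[OF assms, of p]
    by (auto simp: trivial_group_def)
  then show "homology_finite X" unfolding finite_type_def by blast
  show "euler_characteristic X = 0"
    unfolding euler_characteristic_eq_graded
    by (subst graded_euler_eq_sum[of 0]) (simp_all add: *)
qed

lemma set_rank_integer_group:
  "finite_rank integer_group (carrier integer_group)" "set_rank integer_group (carrier integer_group) = 1"
proof -
  interpret G: comm_group integer_group by (rule abelian_integer_group)
  have pow: "x [^]\<^bsub>integer_group\<^esub> (n::int) = n * x" for x n :: int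
    by simp
  have 1: "{1} \<in> indep_sets integer_group (carrier integer_group)"
    by (auto simp: indep_sets_def int_independent_alt int_comb_def pow)
  have "card Z \<le> card {1::int}" if "Z \<in> indep_sets integer_group (carrier integer_group)" for Z
  proof (rule G.int_independent_card_le)
    fix z assume "z \<in> Z"
    have "z [^]\<^bsub>integer_group\<^esub> (1::int) = int_comb integer_group (\<lambda>b. b) (\<lambda>_. z) {1}"
      by (simp add: int_comb_def pow)
    then show "\<exists>m c. m \<noteq> 0 \<and> z [^]\<^bsub>integer_group\<^esub> (m::int) = int_comb integer_group (\<lambda>b. b) c {1}"
      by (metis zero_neq_one)
  qed (use that in \<open>auto simp: indep_sets_def\<close>)
  from set_rankI[OF 1 _ this] show "finite_rank integer_group (carrier integer_group)"
    "set_rank integer_group (carrier integer_group) = 1" by auto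
qed

lemma euler_characteristic_convex:
  fixes S :: "'a::real_normed_vector set"
  assumes "convex S" "S \<noteq> {}"
  shows "homology_finite (top_of_set S)" "euler_characteristic (top_of_set S) = 1"
proof -
  obtain a where a: "a \<in> S" using assms by auto
  have eq: "top_of_set {a} homotopy_equivalent_space top_of_set S"
    using convex_imp_contractible[OF assms(1)] a
    by (intro homotopy_eqv_contractible_sets) auto
  have zero: "homology_group 0 (top_of_set {a}) \<cong> integer_group"
    by (intro isomorphic_integer_zeroth_homology_group contractible_imp_path_connected_space) auto
  have r0: "finite_rank (homology_group 0 (top_of_set {a})) (carrier (homology_group 0 (top_of_set {a})))"
    "set_rank (homology_group 0 (top_of_set {a})) (carrier (homology_group 0 (top_of_set {a}))) = 1"
    using set_rank_iso[OF abelian_integer_group _ group.iso_sym[OF _ zero]] set_rank_integer_group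
    by auto
  have rp: "finite_rank (homology_group p (top_of_set {a})) (carrier (homology_group p (top_of_set {a})))"
    "set_rank (homology_group p (top_of_set {a})) (carrier (homology_group p (top_of_set {a}))) = 0"
    if "p \<noteq> 0" for p
    using set_rank_trivial[of "homology_group p (top_of_set {a})"]
      homology_dimension_axiom[of "top_of_set {a}" a p] that
    by (auto simp: trivial_group_def)
  have fin: "homology_finite (top_of_set {a})"
    using r0 rp unfolding finite_type_def by (metis int_one_le_iff_zero_less not_one_le_zero of_nat_1)
  have e: "euler_characteristic (top_of_set {a}) = 1"
    unfolding euler_characteristic_eq_graded
    by (subst graded_euler_eq_sum[of 1]) (auto simp: r0 rp)
  show "homology_finite (top_of_set S)" "euler_characteristic (top_of_set S) = 1"
    using euler_characteristic_homotopy_equivalent[OF eq fin] e by auto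
qed

section \<open>The Euler characteristic of a union of boxes\<close>

text \<open>The values are forced by two demands on a symmetric weight: a full axis {-1, 0, 1} must
  weigh 0 and a half-axis {0, 1} must weigh 1.\<close>

definition local_weight :: "real \<Rightarrow> int" where
  "local_weight s = (if s = 0 then 2 else - 1)"

definition sign_vectors :: "('n::finite \<Rightarrow> real) set" where
  "sign_vectors = (\<Pi>\<^sub>E i\<in>UNIV. {- 1, 0, 1})"

definition cone_weight :: "(real^'n) set \<Rightarrow> int" where
  "cone_weight \<alpha> = (\<Sum>u\<in>sign_vectors. (\<Prod>i\<in>UNIV. local_weight (u i)) * of_bool ((\<chi> i. u i) \<in> \<alpha>))"

lemma cone_weight_Un: "cone_weight (\<alpha> \<union> \<beta>) = cone_weight \<alpha> + cone_weight \<beta> - cone_weight (\<alpha> \<inter> \<beta>)"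
  unfolding cone_weight_def sum.distrib[symmetric] sum_subtractf[symmetric]
  by (rule sum.cong) (auto simp: of_bool_def)

lemma cone_weight_empty [simp]: "cone_weight {} = 0"
  by (simp add: cone_weight_def)

text \<open>One coordinate of the tangent cone of a box, empty when \<open>t\<close> lies outside
  the interval. For \<open>a = b\<close> both end conditions apply and leave only 0; for
  \<open>a > b\<close> nothing remains.\<close>

definition in_interval_cone :: "real \<Rightarrow> real \<Rightarrow> real \<Rightarrow> real \<Rightarrow> bool" where
  "in_interval_cone a b t s \<longleftrightarrow> a \<le> t \<and> t \<le> b \<and> (t = a \<longrightarrow> 0 \<le> s) \<and> (t = b \<longrightarrow> s \<le> 0)"

definition box_cone :: "real^'n \<Rightarrow> real^'n \<Rightarrow> real^'n \<Rightarrow> (real^'n) set" where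
  "box_cone a b v = {x. \<forall>i. in_interval_cone (a $ i) (b $ i) (v $ i) (x $ i)}"

text \<open>An interior point sees the full axis and weighs 0, an end sees a half-axis and weighs 1,
  the point of a degenerate interval weighs 2. Every nonempty interval thus has total weight
  2.\<close>

lemma interval_weight:
  "(\<Sum>s\<in>{- 1, 0, 1}. local_weight s * of_bool (in_interval_cone a b t s))
     = of_bool (a \<le> b) * (of_bool (t = a) + of_bool (t = b))"
  by (auto simp: local_weight_def in_interval_cone_def)

lemma cone_weight_box_cone:
  "cone_weight (box_cone a b v) =
     (\<Prod>i\<in>UNIV. of_bool (a $ i \<le> b $ i) * (of_bool (v $ i = a $ i) + of_bool (v $ i = b $ i)))"
proof -
  have "cone_weight (box_cone a b v) = (\<Sum>u\<in>sign_vectors. \<Prod>i\<in>UNIV.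
          local_weight (u i) * of_bool (in_interval_cone (a $ i) (b $ i) (v $ i) (u i)))"
    unfolding cone_weight_def
  proof (rule sum.cong)
    fix u :: "'a \<Rightarrow> real"
    have "of_bool ((\<chi> i. u i) \<in> box_cone a b v)
        = (\<Prod>i\<in>UNIV. of_bool (in_interval_cone (a $ i) (b $ i) (v $ i) (u i)) :: int)"
      by (cases "\<forall>i. in_interval_cone (a $ i) (b $ i) (v $ i) (u i)") (auto simp: box_cone_def)
    then show "(\<Prod>i\<in>UNIV. local_weight (u i)) * of_bool ((\<chi> i. u i) \<in> box_cone a b v)
        = (\<Prod>i\<in>UNIV. local_weight (u i) * of_bool (in_interval_cone (a $ i) (b $ i) (v $ i) (u i)))"
      by (simp add: prod.distrib)
  qed simp
  also have "\<dots> = (\<Prod>i\<in>UNIV. \<Sum>s\<in>{- 1, 0, 1}.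
      local_weight s * of_bool (in_interval_cone (a $ i) (b $ i) (v $ i) s))"
    unfolding sign_vectors_def by (rule prod_sum_PiE[symmetric]) auto
  finally show ?thesis by (simp only: interval_weight)
qed

section \<open>Weights of a box summed over a grid\<close>

definition grid :: "real set \<Rightarrow> (real^'n) set" where
  "grid G = {v. \<forall>i. v $ i \<in> G}"

lemma grid_eq_image: "(grid G :: (real^'n) set) = vec_lambda ` (\<Pi>\<^sub>E i\<in>(UNIV :: 'n set). G)" (is "?L = ?R")
proof
  show "?L \<subseteq> ?R"
  proof
    fix v :: "real^'n" assume "v \<in> grid G"
    then have "v = vec_lambda (($) v)" "($) v \<in> (\<Pi>\<^sub>E i\<in>UNIV. G)"
      by (auto simp: grid_def)
    then show "v \<in> ?R" by blast
  qed
qed (auto simp: grid_def)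

lemma finite_grid: "finite G \<Longrightarrow> finite (grid G)"
  by (simp add: grid_eq_image finite_PiE)

text \<open>The sum factors into one sum per axis, and each axis of a nonempty box contributes 2,
  since both its ends are grid values.\<close>

lemma sum_grid_box_cone:
  fixes a b :: "real^'n"
  assumes "finite G" "a \<in> grid G" "b \<in> grid G"
  shows "(\<Sum>v\<in>grid G. cone_weight (box_cone a b v)) = (if \<forall>i. a $ i \<le> b $ i then 2 ^ CARD('n) else 0)"
proof -
  have "(\<Sum>v\<in>grid G. cone_weight (box_cone a b v))
      = (\<Sum>g\<in>(\<Pi>\<^sub>E i\<in>UNIV. G). cone_weight (box_cone a b (vec_lambda g)))"
    unfolding grid_eq_image by (subst sum.reindex) (auto simp: inj_on_def vec_lambda_inject)
  also have "\<dots> = (\<Prod>i\<in>UNIV. \<Sum>t\<in>G. of_bool (a $ i \<le> b $ i) * (of_bool (t = a $ i) + of_bool (t = b $ i)))"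
    unfolding cone_weight_box_cone vec_lambda_beta
    by (rule prod_sum_PiE[symmetric]) (use assms in auto)
  also have "\<dots> = (\<Prod>i\<in>(UNIV::'n set). of_bool (a $ i \<le> b $ i) * 2)"
  proof (rule prod.cong)
    fix i
    have "a $ i \<in> G" "b $ i \<in> G" using assms by (auto simp: grid_def)
    then show "(\<Sum>t\<in>G. of_bool (a $ i \<le> b $ i) * (of_bool (t = a $ i) + of_bool (t = b $ i)))
        = (of_bool (a $ i \<le> b $ i) * 2 :: int)"
      using assms(1) by (simp add: sum_distrib_left[symmetric] sum.distrib of_bool_def)
  qed simp
  also have "\<dots> = (if \<forall>i. a $ i \<le> b $ i then 2 ^ CARD('n) else 0)"
    by (auto simp: prod.distrib)
  finally show ?thesis .
qed

section \<open>Thickened boxes and inclusion-exclusion\<close>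

definition box_meet :: "(real^'n) \<times> (real^'n) \<Rightarrow> (real^'n) \<times> (real^'n) \<Rightarrow> (real^'n) \<times> (real^'n)" where
  "box_meet p q = ((\<chi> i. max (fst p $ i) (fst q $ i)), (\<chi> i. min (snd p $ i) (snd q $ i)))"

definition fat_box :: "real \<Rightarrow> (real^'n) \<times> (real^'n) \<Rightarrow> (real^'n) set" where
  "fat_box \<epsilon> p = box (fst p - (\<chi> i. \<epsilon>)) (snd p + (\<chi> i. \<epsilon>))"

lemma mem_fat_box: "x \<in> fat_box \<epsilon> p \<longleftrightarrow> (\<forall>i. fst p $ i - \<epsilon> < x $ i \<and> x $ i < snd p $ i + \<epsilon>)"
  by (simp add: fat_box_def mem_box_cart)

text \<open>Boxes are kept as pairs of corners, so the identity also covers meets that are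
  degenerate or have their corners in the wrong order.\<close>

lemma fat_box_meet: "fat_box \<epsilon> (box_meet p q) = fat_box \<epsilon> p \<inter> fat_box \<epsilon> q"
  by (auto simp: mem_fat_box box_meet_def max_def min_def) (smt (verit))+

lemma box_cone_meet:
  "box_cone (fst (box_meet p q)) (snd (box_meet p q)) v
     = box_cone (fst p) (snd p) v \<inter> box_cone (fst q) (snd q) v"
proof -
  have "in_interval_cone (max a a') (min b b') t s \<longleftrightarrow> in_interval_cone a b t s \<and> in_interval_cone a' b' t s"
    for a a' b b' t s by (auto simp: in_interval_cone_def max_def min_def)
  then show ?thesis by (auto simp: box_cone_def box_meet_def)
qed

lemma box_meet_grid:
  "\<lbrakk>fst p \<in> grid G; snd p \<in> grid G; fst q \<in> grid G; snd q \<in> grid G\<rbrakk>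
    \<Longrightarrow> fst (box_meet p q) \<in> grid G \<and> snd (box_meet p q) \<in> grid G"
  by (auto simp: box_meet_def grid_def max_def min_def)

lemma fat_box_euler:
  fixes p :: "(real^'n) \<times> (real^'n)"
  assumes "\<epsilon> > 0" and sep: "\<And>g h. \<lbrakk>g \<in> G; h \<in> G; g < h\<rbrakk> \<Longrightarrow> g + \<epsilon> \<le> h - \<epsilon>"
    and p: "fst p \<in> grid G" "snd p \<in> grid G"
  shows "homology_finite (top_of_set (fat_box \<epsilon> p))"
    and "euler_characteristic (top_of_set (fat_box \<epsilon> p)) = (if \<forall>i. fst p $ i \<le> snd p $ i then 1 else 0)"
proof -
  have "homology_finite (top_of_set (fat_box \<epsilon> p)) \<and>
    euler_characteristic (top_of_set (fat_box \<epsilon> p)) = (if \<forall>i. fst p $ i \<le> snd p $ i then 1 else 0)"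
  proof (cases "\<forall>i. fst p $ i \<le> snd p $ i")
    case True
    then have "fst p \<in> fat_box \<epsilon> p" using \<open>\<epsilon> > 0\<close> by (auto simp: mem_fat_box) (smt (verit))
    then have "fat_box \<epsilon> p \<noteq> {}" by auto
    moreover have "convex (fat_box \<epsilon> p)" by (simp add: fat_box_def)
    ultimately show ?thesis using euler_characteristic_convex[of "fat_box \<epsilon> p"] True by auto
  next
    case False
    then obtain i where i: "snd p $ i < fst p $ i" by (auto simp: not_le)
    \<comment> \<open>A pair in the wrong order stays empty after thickening because the gap between
      grid values is at least \<open>2 * \<epsilon>\<close>.\<close>
    then have "snd p $ i + \<epsilon> \<le> fst p $ i - \<epsilon>" using sep p by (auto simp: grid_def)
    then have "fat_box \<epsilon> p = {}" by (auto simp: mem_fat_box) (smt (verit))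
    then show ?thesis using euler_characteristic_empty[of "top_of_set (fat_box \<epsilon> p)"] False by auto
  qed
  then show "homology_finite (top_of_set (fat_box \<epsilon> p))"
    "euler_characteristic (top_of_set (fat_box \<epsilon> p)) = (if \<forall>i. fst p $ i \<le> snd p $ i then 1 else 0)"
    by auto
qed

text \<open>Induction on the length of the list: the part of the tail inside the box
  \<open>p\<close> is the union of the meets in \<open>map (box_meet p) qs\<close>, a list as long
  as the tail and on the same grid, so the induction hypothesis covers it too.\<close>

lemma euler_fat_boxes:
  fixes ps :: "((real^'n) \<times> (real^'n)) list"
  assumes G: "finite G" and \<epsilon>: "\<epsilon> > 0" and sep: "\<And>g h. \<lbrakk>g \<in> G; h \<in> G; g < h\<rbrakk> \<Longrightarrow> g + \<epsilon> \<le> h - \<epsilon>"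
    and ps: "\<forall>p\<in>set ps. fst p \<in> grid G \<and> snd p \<in> grid G"
  shows "homology_finite (top_of_set (\<Union>p\<in>set ps. fat_box \<epsilon> p)) \<and>
     2 ^ CARD('n) * euler_characteristic (top_of_set (\<Union>p\<in>set ps. fat_box \<epsilon> p))
       = (\<Sum>v\<in>grid G. cone_weight (\<Union>p\<in>set ps. box_cone (fst p) (snd p) v))"
  using ps
proof (induction "length ps" arbitrary: ps)
  case 0
  then show ?case using euler_characteristic_empty[of "top_of_set {}"] by simp
next
  case (Suc n)
  then obtain p qs where ps: "ps = p # qs" by (cases ps) auto
  have p: "fst p \<in> grid G" "snd p \<in> grid G" using Suc ps by auto
  let ?U = "\<lambda>ps. \<Union>p\<in>set ps. fat_box \<epsilon> p"
  let ?C = "\<lambda>ps v. \<Union>p\<in>set ps. box_cone (fst p) (snd p) v"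
  let ?ms = "map (box_meet p) qs"
  have IH1: "homology_finite (top_of_set (?U qs))"
    "2 ^ CARD('n) * euler_characteristic (top_of_set (?U qs)) = (\<Sum>v\<in>grid G. cone_weight (?C qs v))"
    using Suc.hyps(1)[of qs] Suc.hyps(2) Suc.prems ps by auto
  have IH2: "homology_finite (top_of_set (?U ?ms))"
    "2 ^ CARD('n) * euler_characteristic (top_of_set (?U ?ms)) = (\<Sum>v\<in>grid G. cone_weight (?C ?ms v))"
    using Suc.hyps(1)[of ?ms] Suc.hyps(2) Suc.prems ps box_meet_grid[OF p] by auto
  have U: "?U ps = fat_box \<epsilon> p \<union> ?U qs" "?U ?ms = fat_box \<epsilon> p \<inter> ?U qs"
    using ps by (auto simp: fat_box_meet)
  have C: "?C ps v = box_cone (fst p) (snd p) v \<union> ?C qs v"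
    "?C ?ms v = box_cone (fst p) (snd p) v \<inter> ?C qs v" for v
    using ps by (auto simp: box_cone_meet)
  have op: "open (fat_box \<epsilon> q)" for q :: "(real^'n) \<times> (real^'n)" by (simp add: fat_box_def open_box)
  note b = fat_box_euler[OF \<epsilon> sep p]
  have c: "2 ^ CARD('n) * euler_characteristic (top_of_set (fat_box \<epsilon> p))
      = (\<Sum>v\<in>grid G. cone_weight (box_cone (fst p) (snd p) v))"
    using b(2) sum_grid_box_cone[OF G p] by simp
  note add = euler_characteristic_open_Un[OF op _ b(1) IH1(1) IH2(1)[unfolded U]]
  have "homology_finite (top_of_set (?U ps))" unfolding U by (rule add) (auto simp: op)
  moreover have "euler_characteristic (top_of_set (?U ps)) = euler_characteristic (top_of_set (fat_box \<epsilon> p))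
      + euler_characteristic (top_of_set (?U qs)) - euler_characteristic (top_of_set (?U ?ms))"
    unfolding U by (rule add) (auto simp: op)
  then have "2 ^ CARD('n) * euler_characteristic (top_of_set (?U ps)) =
      (\<Sum>v\<in>grid G. cone_weight (box_cone (fst p) (snd p) v)) + (\<Sum>v\<in>grid G. cone_weight (?C qs v))
      - (\<Sum>v\<in>grid G. cone_weight (?C ?ms v))"
    by (simp only: c[symmetric] IH1(2)[symmetric] IH2(2)[symmetric]) (simp add: algebra_simps)
  then have "2 ^ CARD('n) * euler_characteristic (top_of_set (?U ps)) = (\<Sum>v\<in>grid G. cone_weight (?C ps v))"
    unfolding C cone_weight_Un by (simp add: sum.distrib sum_subtractf)
  ultimately show ?case by blast
qed

subsection \<open>Collapsing a neighbourhood of the grid\<close>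

text \<open>The factor 4 keeps the open intervals of radius \<open>2 * \<epsilon>\<close> around
  different grid values disjoint, which separates the bumps in
  \<open>collapse_exists\<close>.\<close>

lemma finite_gap:
  fixes G :: "real set"
  assumes "finite G"
  shows "\<exists>\<epsilon>>0. \<forall>g\<in>G. \<forall>h\<in>G. g < h \<longrightarrow> g + 4 * \<epsilon> \<le> h"
proof -
  \<comment> \<open>The inserted 1 serves grids without two distinct values, where the set of
    differences is empty.\<close>
  define D where "D = insert 1 ((\<lambda>(g, h). h - g) ` {(g, h) \<in> G \<times> G. g < h})"
  have "finite {(g, h) \<in> G \<times> G. g < h}" by (rule finite_subset[of _ "G \<times> G"]) (use assms in auto)
  then have "finite D" "D \<noteq> {}" by (auto simp: D_def)
  then have "Min D > 0" by (auto simp: D_def)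
  moreover have "g + Min D \<le> h" if "g \<in> G" "h \<in> G" "g < h" for g h
  proof -
    have "h - g \<in> D" using that by (auto simp: D_def)
    then have "Min D \<le> h - g" using \<open>finite D\<close> by simp
    then show ?thesis by simp
  qed
  ultimately show ?thesis by (intro exI[of _ "Min D / 4"]) auto
qed

text \<open>\<open>r\<close> squeezes the \<open>\<epsilon>\<close>-neighbourhood of each grid value
  to that value and is the identity at distance \<open>2 * \<epsilon>\<close> and more. The last two
  properties say that it moves a thickened interval with grid ends into the original one.\<close>

lemma collapse_exists:
  fixes G :: "real set"
  assumes "finite G"
  obtains \<epsilon> r where "\<epsilon> > 0" "continuous_on UNIV r"
    "\<And>g h. \<lbrakk>g \<in> G; h \<in> G; g < h\<rbrakk> \<Longrightarrow> g + \<epsilon> \<le> h - \<epsilon>"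
    "\<And>a x. \<lbrakk>a \<in> G; a - \<epsilon> < x\<rbrakk> \<Longrightarrow> a \<le> r x" "\<And>b x. \<lbrakk>b \<in> G; x < b + \<epsilon>\<rbrakk> \<Longrightarrow> r x \<le> b"
proof -
  obtain \<epsilon> where \<epsilon>: "\<epsilon> > 0" and gap: "\<And>g h. \<lbrakk>g \<in> G; h \<in> G; g < h\<rbrakk> \<Longrightarrow> g + 4 * \<epsilon> \<le> h"
    using finite_gap[OF assms] by blast
  \<comment> \<open>The cutoff factor falls linearly from 1 to 0 between \<open>\<epsilon>\<close>
    and \<open>2 * \<epsilon>\<close>. Subtracting \<open>\<psi> (x - g)\<close> pulls
    \<open>x\<close> towards \<open>g\<close>, and all the way when \<open>x\<close> is within
    \<open>\<epsilon>\<close> of it.\<close>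
  define \<psi> :: "real \<Rightarrow> real" where "\<psi> y = max 0 (min 1 (2 - \<bar>y\<bar> / \<epsilon>)) * y" for y
  define r where "r x = x - (\<Sum>g\<in>G. \<psi> (x - g))" for x
  have \<psi>0: "\<psi> y = 0" if "\<bar>y\<bar> \<ge> 2 * \<epsilon>" for y
    using that \<epsilon> by (simp add: \<psi>_def field_simps max_def)
  have \<psi>id: "\<psi> y = y" if "\<bar>y\<bar> \<le> \<epsilon>" for y
    using that \<epsilon> by (simp add: \<psi>_def field_simps max_def min_def)
  have \<psi>_pos: "0 \<le> \<psi> y \<and> \<psi> y \<le> y" if "0 \<le> y" for y
    using that mult_right_mono[of "max 0 (min 1 (2 - \<bar>y\<bar> / \<epsilon>))" 1 y] by (auto simp: \<psi>_def)
  have \<psi>_odd: "\<psi> (- y) = - \<psi> y" for y by (simp add: \<psi>_def)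
  have \<psi>_neg: "y \<le> \<psi> y \<and> \<psi> y \<le> 0" if "y \<le> 0" for y
    using \<psi>_pos[of "- y"] that by (simp add: \<psi>_odd)
  \<comment> \<open>The gaps leave at most one nonzero term in the sum.\<close>
  have near: "r x = x - \<psi> (x - g)" if "g \<in> G" "\<bar>x - g\<bar> < 2 * \<epsilon>" for x g
  proof -
    have "\<psi> (x - h) = 0" if "h \<in> G - {g}" for h
    proof (rule \<psi>0)
      have "g + 4 * \<epsilon> \<le> h \<or> h + 4 * \<epsilon> \<le> g" using gap that \<open>g \<in> G\<close> by (cases "g < h") auto
      then show "\<bar>x - h\<bar> \<ge> 2 * \<epsilon>" using \<open>\<bar>x - g\<bar> < 2 * \<epsilon>\<close> by auto
    qed
    then show ?thesis using assms \<open>g \<in> G\<close> by (simp add: r_def sum.remove[of G g])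
  qed
  have far: "r x = x" if "\<And>g. g \<in> G \<Longrightarrow> \<bar>x - g\<bar> \<ge> 2 * \<epsilon>" for x
    using that by (simp add: r_def \<psi>0)
  have lower: "a \<le> r x" if "a \<in> G" and ax: "a - \<epsilon> < x" for a x
  proof (cases "\<exists>g\<in>G. \<bar>x - g\<bar> < 2 * \<epsilon>")
    case True
    then obtain g where g: "g \<in> G" "\<bar>x - g\<bar> < 2 * \<epsilon>" by auto
    have rx: "r x = x - \<psi> (x - g)" using near g by auto
    have "\<not> g < a" using gap[of g a] g that \<epsilon> by auto
    then consider "g = a" "\<bar>x - a\<bar> \<le> \<epsilon>" | "g = a" "x > a + \<epsilon>" | "g > a" using ax by fastforce
    then show ?thesis
    proof cases
      case 1
      then show ?thesis using rx \<psi>id by auto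
    next
      case 2
      then show ?thesis using rx \<psi>_pos[of "x - g"] \<epsilon> by auto
    next
      \<comment> \<open>\<open>r x\<close> lies between \<open>x\<close> and \<open>g\<close>, and
        both exceed \<open>a\<close>.\<close>
      case 3
      then have "x > a" using gap[of a g] g that \<epsilon> by auto
      then show ?thesis using rx \<psi>_pos[of "x - g"] \<psi>_neg[of "x - g"] 3 by (cases "x \<ge> g") auto
    qed
  next
    case False
    then have "\<bar>x - a\<bar> \<ge> 2 * \<epsilon>" using that by force
    then show ?thesis using far[of x] False that \<epsilon> by (auto simp: not_less)
  qed
  have upper: "r x \<le> b" if "b \<in> G" and xb: "x < b + \<epsilon>" for b x
  proof (cases "\<exists>g\<in>G. \<bar>x - g\<bar> < 2 * \<epsilon>")
    case True
    then obtain g where g: "g \<in> G" "\<bar>x - g\<bar> < 2 * \<epsilon>" by auto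
    have rx: "r x = x - \<psi> (x - g)" using near g by auto
    have "\<not> b < g" using gap[of b g] g that \<epsilon> by auto
    then consider "g = b" "\<bar>x - b\<bar> \<le> \<epsilon>" | "g = b" "x < b - \<epsilon>" | "g < b" using xb by fastforce
    then show ?thesis
    proof cases
      case 1
      then show ?thesis using rx \<psi>id by auto
    next
      case 2
      then show ?thesis using rx \<psi>_neg[of "x - g"] \<epsilon> by auto
    next
      case 3
      then have "x < b" using gap[of g b] g that \<epsilon> by auto
      then show ?thesis using rx \<psi>_pos[of "x - g"] \<psi>_neg[of "x - g"] 3 by (cases "x \<ge> g") auto
    qed
  next
    case False
    then have "\<bar>x - b\<bar> \<ge> 2 * \<epsilon>" using that by force
    then show ?thesis using far[of x] False that \<epsilon> by (auto simp: not_less)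
  qed
  have "continuous_on UNIV r"
    unfolding r_def \<psi>_def using \<epsilon> by (intro continuous_intros) auto
  then show thesis using that[OF \<epsilon> _ _ lower upper] gap \<epsilon> by fastforce
qed

text \<open>The coordinatewise collapse carries each fat box into its closed box. It need not fix
  closed boxes pointwise, so both composites need a homotopy; straight lines work on the whole union
  because a point and its image share one convex box of it.\<close>

lemma fat_boxes_homotopy_equivalent:
  fixes ps :: "((real^'n) \<times> (real^'n)) set"
  assumes \<epsilon>: "\<epsilon> > 0" and cont: "continuous_on UNIV r"
    and lower: "\<And>a x. \<lbrakk>a \<in> G; a - \<epsilon> < x\<rbrakk> \<Longrightarrow> a \<le> r x"
    and upper: "\<And>b x. \<lbrakk>b \<in> G; x < b + \<epsilon>\<rbrakk> \<Longrightarrow> r x \<le> b"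
    and ps: "\<forall>p\<in>ps. fst p \<in> grid G \<and> snd p \<in> grid G"
  shows "top_of_set (\<Union>p\<in>ps. fat_box \<epsilon> p) homotopy_equivalent_space top_of_set (\<Union>p\<in>ps. cbox (fst p) (snd p))"
proof -
  define \<rho> :: "real^'n \<Rightarrow> real^'n" where "\<rho> x = (\<chi> i. r (x $ i))" for x
  let ?F = "\<Union>p\<in>ps. fat_box \<epsilon> p" and ?P = "\<Union>p\<in>ps. cbox (fst p) (snd p)"
  have cont\<rho>: "continuous_on S \<rho>" for S
    unfolding \<rho>_def
    by (intro continuous_on_vec_lambda continuous_on_compose2[OF cont] continuous_intros) auto
  have \<rho>in: "\<rho> x \<in> cbox (fst p) (snd p)" if "p \<in> ps" "x \<in> fat_box \<epsilon> p" for p x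
    using that ps lower upper by (auto simp: mem_box_cart \<rho>_def mem_fat_box grid_def)
  have sub: "cbox (fst p) (snd p) \<subseteq> fat_box \<epsilon> p" for p :: "(real^'n) \<times> (real^'n)"
    using \<epsilon> by (auto simp: mem_box_cart mem_fat_box) (smt (verit))+
  have conv: "convex (fat_box \<epsilon> p)" for p :: "(real^'n) \<times> (real^'n)" by (simp add: fat_box_def)
  show ?thesis
    unfolding homotopy_equivalent_space_def
  proof (intro exI conjI)
    show "continuous_map (top_of_set ?F) (top_of_set ?P) \<rho>"
      using \<rho>in by (auto simp: cont\<rho>)
    show "continuous_map (top_of_set ?P) (top_of_set ?F) id"
      using sub by (auto simp: continuous_on_id) blast
    show "homotopic_with (\<lambda>x. True) (top_of_set ?F) (top_of_set ?F) (id \<circ> \<rho>) id"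
    proof (rule homotopic_with_linear)
      fix x assume "x \<in> ?F"
      then obtain p where p: "p \<in> ps" "x \<in> fat_box \<epsilon> p" by auto
      then have "closed_segment ((id \<circ> \<rho>) x) (id x) \<subseteq> fat_box \<epsilon> p"
        using \<rho>in[of p x] sub[of p] by (intro closed_segment_subset conv) auto
      then show "closed_segment ((id \<circ> \<rho>) x) (id x) \<subseteq> ?F" using p by blast
    qed (auto simp: cont\<rho> continuous_on_id)
    show "homotopic_with (\<lambda>x. True) (top_of_set ?P) (top_of_set ?P) (\<rho> \<circ> id) id"
    proof (rule homotopic_with_linear)
      fix x assume "x \<in> ?P"
      then obtain p where p: "p \<in> ps" "x \<in> cbox (fst p) (snd p)" by auto
      then have "closed_segment ((\<rho> \<circ> id) x) (id x) \<subseteq> cbox (fst p) (snd p)"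
        using \<rho>in[of p x] sub[of p] by (intro closed_segment_subset) auto
      then show "closed_segment ((\<rho> \<circ> id) x) (id x) \<subseteq> ?P" using p by blast
    qed (auto simp: cont\<rho> continuous_on_id)
  qed
qed

lemma euler_characteristic_boxes:
  fixes ps :: "((real^'n) \<times> (real^'n)) set"
  assumes G: "finite G" and fin: "finite ps" and ps: "\<forall>p\<in>ps. fst p \<in> grid G \<and> snd p \<in> grid G"
  shows "2 ^ CARD('n) * euler_characteristic (top_of_set (\<Union>p\<in>ps. cbox (fst p) (snd p)))
       = (\<Sum>v\<in>grid G. cone_weight (\<Union>p\<in>ps. box_cone (fst p) (snd p) v))"
proof -
  obtain qs where qs: "set qs = ps" using finite_list[OF fin] by auto
  obtain \<epsilon> r where r: "\<epsilon> > 0" "continuous_on UNIV r"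
    "\<And>g h. \<lbrakk>g \<in> G; h \<in> G; g < h\<rbrakk> \<Longrightarrow> g + \<epsilon> \<le> h - \<epsilon>"
    "\<And>a x. \<lbrakk>a \<in> G; a - \<epsilon> < x\<rbrakk> \<Longrightarrow> a \<le> r x" "\<And>b x. \<lbrakk>b \<in> G; x < b + \<epsilon>\<rbrakk> \<Longrightarrow> r x \<le> b"
    using collapse_exists[OF G] by metis
  note e = euler_fat_boxes[OF G r(1,3), of qs, unfolded qs, OF _ _ _ ps]
  note h = fat_boxes_homotopy_equivalent[OF r(1,2,4,5) ps]
  show ?thesis using euler_characteristic_homotopy_equivalent(2)[OF h] e by auto
qed

section \<open>The weight of a floral vertex\<close>

text \<open>Assignments are \<open>undefined\<close> outside \<open>E\<close>;
  \<open>depends_on\<close> says that a condition does not look there, which allows splitting a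
  weight over disjoint edge sets.\<close>

definition partial_weight :: "'n set \<Rightarrow> (('n \<Rightarrow> real) \<Rightarrow> bool) \<Rightarrow> int" where
  "partial_weight E Q = (\<Sum>u\<in>(\<Pi>\<^sub>E i\<in>E. {- 1, 0, 1}). (\<Prod>i\<in>E. local_weight (u i)) * of_bool (Q u))"

definition depends_on :: "'n set \<Rightarrow> (('n \<Rightarrow> real) \<Rightarrow> bool) \<Rightarrow> bool" where
  "depends_on E Q \<longleftrightarrow> (\<forall>u u'. (\<forall>i\<in>E. u i = u' i) \<longrightarrow> Q u = Q u')"

lemma depends_onD: "\<lbrakk>depends_on E Q; \<And>i. i \<in> E \<Longrightarrow> u i = u' i\<rbrakk> \<Longrightarrow> Q u = Q u'"
  by (auto simp: depends_on_def)

lemma depends_on_conj: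
  assumes "depends_on E Q" "depends_on F R"
  shows "depends_on (E \<union> F) (\<lambda>u. Q u \<and> R u)"
  unfolding depends_on_def using depends_onD[OF assms(1)] depends_onD[OF assms(2)] by (metis UnI1 UnI2)

lemma depends_on_disj:
  assumes "depends_on E Q" "depends_on F R"
  shows "depends_on (E \<union> F) (\<lambda>u. Q u \<or> R u)"
  unfolding depends_on_def using depends_onD[OF assms(1)] depends_onD[OF assms(2)] by (metis UnI1 UnI2)

lemma cone_weight_eq_partial: "cone_weight \<alpha> = partial_weight UNIV (\<lambda>u. (\<chi> i. u i) \<in> \<alpha>)"
  by (simp add: cone_weight_def partial_weight_def sign_vectors_def)

text \<open>Each coordinate sums to 2 - 1 - 1 = 0, so only the empty product survives.\<close>

lemma partial_weight_True: "finite E \<Longrightarrow> partial_weight E (\<lambda>_. True) = of_bool (E = {})"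
proof -
  assume "finite E"
  have "partial_weight E (\<lambda>_. True) = (\<Prod>i\<in>E. \<Sum>s\<in>{- 1, 0, 1 :: real}. local_weight s)"
    unfolding partial_weight_def using prod_sum_PiE[OF \<open>finite E\<close>, of "\<lambda>_. {- 1, 0, 1 :: real}" "\<lambda>_. local_weight"]
    by simp
  also have "(\<Sum>s\<in>{- 1, 0, 1 :: real}. local_weight s) = 0" by (simp add: local_weight_def)
  finally show ?thesis using \<open>finite E\<close> by (cases "E = {}") auto
qed

text \<open>An assignment on the union is a pair of assignments on the parts, and both weight and
  condition factor accordingly.\<close>

lemma partial_weight_conj:
  assumes "finite E" "finite F" "E \<inter> F = {}" "depends_on E Q" "depends_on F R"
  shows "partial_weight (E \<union> F) (\<lambda>u. Q u \<and> R u) = partial_weight E Q * partial_weight F R"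
proof -
  let ?B = "\<lambda>_. {- 1, 0, 1 :: real}"
  have "partial_weight E Q * partial_weight F R =
    (\<Sum>(f, g)\<in>Pi\<^sub>E E ?B \<times> Pi\<^sub>E F ?B. ((\<Prod>i\<in>E. local_weight (f i)) * of_bool (Q f)) * ((\<Prod>i\<in>F. local_weight (g i)) * of_bool (R g)))"
    unfolding partial_weight_def by (simp add: sum_product sum.cartesian_product)
  also have "\<dots> = partial_weight (E \<union> F) (\<lambda>u. Q u \<and> R u)"
    unfolding partial_weight_def
  proof (rule sum.reindex_bij_witness[where i = "\<lambda>u. (restrict u E, restrict u F)"
        and j = "\<lambda>(f, g). \<lambda>i. if i \<in> E then f i else if i \<in> F then g i else undefined"])
    fix x assume x: "x \<in> Pi\<^sub>E E ?B \<times> Pi\<^sub>E F ?B"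
    obtain f g where fg: "x = (f, g)" by force
    let ?u = "\<lambda>i. if i \<in> E then f i else if i \<in> F then g i else undefined"
    have F: "i \<in> F \<Longrightarrow> i \<notin> E" for i using assms(3) by auto
    have "restrict ?u E = f" "restrict ?u F = g"
      using x fg F by (auto simp: restrict_def PiE_def extensional_def fun_eq_iff)
    then show "(restrict (case x of (f, g) \<Rightarrow> \<lambda>i. if i \<in> E then f i else if i \<in> F then g i else undefined) E,
        restrict (case x of (f, g) \<Rightarrow> \<lambda>i. if i \<in> E then f i else if i \<in> F then g i else undefined) F) = x"
      using fg by simp
    show "(case x of (f, g) \<Rightarrow> \<lambda>i. if i \<in> E then f i else if i \<in> F then g i else undefined) \<in> Pi\<^sub>E (E \<union> F) ?B"
      using x fg by (auto simp: PiE_iff extensional_def)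
    have Q: "Q ?u = Q f" by (rule depends_onD[OF assms(4)]) auto
    have R: "R ?u = R g" by (rule depends_onD[OF assms(5)]) (use F in auto)
    have "(\<Prod>i\<in>E \<union> F. local_weight (?u i)) = (\<Prod>i\<in>E. local_weight (?u i)) * (\<Prod>i\<in>F. local_weight (?u i))"
      using assms by (intro prod.union_disjoint) auto
    also have "(\<Prod>i\<in>E. local_weight (?u i)) = (\<Prod>i\<in>E. local_weight (f i))" by (rule prod.cong) auto
    also have "(\<Prod>i\<in>F. local_weight (?u i)) = (\<Prod>i\<in>F. local_weight (g i))"
      by (rule prod.cong) (use F in auto)
    finally show "(\<Prod>i\<in>E \<union> F. local_weight ((case x of (f, g) \<Rightarrow> \<lambda>i. if i \<in> E then f i else if i \<in> F then g i else undefined) i)) *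
        of_bool (Q (case x of (f, g) \<Rightarrow> \<lambda>i. if i \<in> E then f i else if i \<in> F then g i else undefined) \<and>
          R (case x of (f, g) \<Rightarrow> \<lambda>i. if i \<in> E then f i else if i \<in> F then g i else undefined)) =
      (case x of (f, g) \<Rightarrow> ((\<Prod>i\<in>E. local_weight (f i)) * of_bool (Q f)) * ((\<Prod>i\<in>F. local_weight (g i)) * of_bool (R g)))"
      using Q R by (simp add: fg of_bool_conj)
  next
    fix u assume "u \<in> Pi\<^sub>E (E \<union> F) ?B"
    then show "(case (restrict u E, restrict u F) of (f, g) \<Rightarrow> \<lambda>i. if i \<in> E then f i else if i \<in> F then g i else undefined) = u"
      by (auto simp: fun_eq_iff PiE_def extensional_def)
    show "(restrict u E, restrict u F) \<in> Pi\<^sub>E E ?B \<times> Pi\<^sub>E F ?B"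
      using \<open>u \<in> Pi\<^sub>E (E \<union> F) ?B\<close> by (auto simp: PiE_iff)
  qed
  finally show ?thesis by simp
qed

lemma partial_weight_disj:
  "partial_weight E (\<lambda>u. Q u \<or> R u) = partial_weight E Q + partial_weight E R - partial_weight E (\<lambda>u. Q u \<and> R u)"
  unfolding partial_weight_def sum.distrib[symmetric] sum_subtractf[symmetric]
  by (rule sum.cong) (auto simp: of_bool_def)

text \<open>The coordinates in \<open>F\<close> are free: \<open>Q\<close> is its own conjunction
  with truth on \<open>F\<close>, which weighs 0.\<close>

lemma partial_weight_Un_left:
  assumes "finite E" "finite F" "E \<inter> F = {}" "F \<noteq> {}" "depends_on E Q"
  shows "partial_weight (E \<union> F) Q = 0"
  using partial_weight_conj[OF assms(1,2,3,5), of "\<lambda>_. True"] assms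
  by (simp add: partial_weight_True depends_on_def)

lemma mem_floral_set_Edge:
  assumes "s i = 1 \<or> s i = - 1"
  shows "x \<in> floral_set s (Edge i) \<longleftrightarrow> 0 \<le> s i * x $ i"
proof
  assume "0 \<le> s i * x $ i"
  then have "s i *\<^sub>R x \<in> coord_halfspace i" by (simp add: coord_halfspace_def)
  moreover have "x = s i *\<^sub>R (s i *\<^sub>R x)" using assms by auto
  ultimately show "x \<in> floral_set s (Edge i)" by (metis floral_set.simps(2) image_eqI)
qed (use assms in \<open>auto simp: coord_halfspace_def\<close>)

lemma depends_on_floral_set:
  assumes "range s \<subseteq> {- 1, 1}"
  shows "depends_on (spd_edges D) (\<lambda>u. (\<chi> i. u i) \<in> floral_set s D)"
proof (induction D)
  case (Edge i)
  have "s i = 1 \<or> s i = - 1" using assms by auto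
  then show ?case by (auto simp: depends_on_def mem_floral_set_Edge simp del: floral_set.simps)
next
  case (Series D1 D2)
  show ?case using depends_on_conj[OF Series] by simp
next
  case (Parallel D1 D2)
  show ?case using depends_on_disj[OF Parallel] by simp
qed (simp add: depends_on_def)

text \<open>A series connection is a conjunction over disjoint edge sets, hence a product. For a
  parallel connection inclusion-exclusion applies: each part alone leaves the edges of the other
  free and weighs 0, so only the negated product remains.\<close>

lemma partial_weight_floral_set:
  fixes s :: "'n::finite \<Rightarrow> real"
  assumes s: "range s \<subseteq> {- 1, 1}" and D: "valid_spd D"
  shows "partial_weight (spd_edges D) (\<lambda>u. (\<chi> i. u i) \<in> floral_set s D) = spd_sign D"
  using D
proof (induction D)
  case SingleVertex
  then show ?case by (simp add: partial_weight_def spd_sign_SingleVertex)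
next
  case (Edge i)
  have si: "s i = 1 \<or> s i = - 1" using s by auto
  have "partial_weight {i} (\<lambda>u. (\<chi> i. u i) \<in> floral_set s (Edge i))
     = (\<Sum>u\<in>(\<Pi>\<^sub>E j\<in>{i}. {- 1, 0, 1}). \<Prod>j\<in>{i}. local_weight (u j) * of_bool (0 \<le> s j * u j))"
    unfolding partial_weight_def using si by (simp add: mem_floral_set_Edge del: floral_set.simps)
  also have "\<dots> = (\<Prod>j\<in>{i}. \<Sum>y\<in>{- 1, 0, 1 :: real}. local_weight y * of_bool (0 \<le> s j * y))"
    by (rule prod_sum_PiE[symmetric]) auto
  also have "\<dots> = 1" using si by (auto simp: local_weight_def)
  finally show ?case by (simp add: spd_sign_Edge del: floral_set.simps)
next
  case (Series D1 D2)
  then show ?case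
    using partial_weight_conj[OF _ _ _ depends_on_floral_set[OF s, of D1] depends_on_floral_set[OF s, of D2]]
    by (simp add: spd_sign_Series)
next
  case (Parallel D1 D2)
  let ?Q = "\<lambda>D u. (\<chi> i. u i) \<in> floral_set s D"
  have "partial_weight (spd_edges D1 \<union> spd_edges D2) (?Q D1) = 0"
    by (rule partial_weight_Un_left) (use Parallel depends_on_floral_set[OF s] in auto)
  moreover have "partial_weight (spd_edges D2 \<union> spd_edges D1) (?Q D2) = 0"
    by (rule partial_weight_Un_left) (use Parallel depends_on_floral_set[OF s] in auto)
  moreover have "partial_weight (spd_edges D1 \<union> spd_edges D2) (\<lambda>u. ?Q D1 u \<and> ?Q D2 u) = spd_sign D1 * spd_sign D2"
    using partial_weight_conj[OF _ _ _ depends_on_floral_set[OF s, of D1] depends_on_floral_set[OF s, of D2]] Parallel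
    by simp
  ultimately show ?case
    using Parallel.prems by (simp add: spd_sign_Parallel partial_weight_disj Un_commute)
qed

text \<open>The weight is computed from the set alone, so all diagrams determining
  \<open>\<alpha>\<close> have the same sign; this is also why the description in
  \<open>floral_sign\<close> is well defined.\<close>

lemma floral_sign_eq_cone_weight:
  assumes "floral_vertex \<alpha>"
  shows "floral_sign \<alpha> = cone_weight \<alpha>"
proof -
  have *: "spd_sign D = cone_weight \<alpha>" if "floral_vertex_of s D \<alpha>" for s D
    using that partial_weight_floral_set[of s D]
    by (auto simp: floral_vertex_of_def cone_weight_eq_partial)
  obtain s D where "floral_vertex_of s D \<alpha>" using assms by (auto simp: floral_vertex_def)
  then show ?thesis unfolding floral_sign_def using *[of s D] * by (intro the_equality) fastforce+
qed

section \<open>Cones with a free axis\<close>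

definition cylinder :: "'n \<Rightarrow> (real^'n) set \<Rightarrow> bool" where
  "cylinder i \<alpha> \<longleftrightarrow> (\<forall>x y. (\<forall>j. j \<noteq> i \<longrightarrow> x $ j = y $ j) \<longrightarrow> x \<in> \<alpha> \<longrightarrow> y \<in> \<alpha>)"

lemma cylinderD: "\<lbrakk>cylinder i \<alpha>; \<And>j. j \<noteq> i \<Longrightarrow> x $ j = y $ j\<rbrakk> \<Longrightarrow> x \<in> \<alpha> \<longleftrightarrow> y \<in> \<alpha>"
proof -
  assume *: "cylinder i \<alpha>" "\<And>j. j \<noteq> i \<Longrightarrow> x $ j = y $ j"
  show "x \<in> \<alpha> \<longleftrightarrow> y \<in> \<alpha>"
    using *(1)[unfolded cylinder_def, rule_format, of x y] *(1)[unfolded cylinder_def, rule_format, of y x] *(2)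
    by auto
qed

lemma cone_weight_cylinder:
  assumes "cylinder i \<alpha>"
  shows "cone_weight \<alpha> = 0"
proof -
  have "depends_on (- {i}) (\<lambda>u. (\<chi> i. u i) \<in> \<alpha>)"
    unfolding depends_on_def using cylinderD[OF assms] by (metis ComplI singletonD vec_lambda_beta)
  then have "partial_weight (- {i} \<union> {i}) (\<lambda>u. (\<chi> i. u i) \<in> \<alpha>) = 0"
    by (intro partial_weight_Un_left) auto
  moreover have "- {i} \<union> {i} = UNIV" by auto
  ultimately show ?thesis by (simp only: cone_weight_eq_partial)
qed

section \<open>Tangent cones\<close>

lemma mem_cube: "x \<in> cube \<delta> \<longleftrightarrow> (\<forall>i. \<bar>x $ i\<bar> \<le> \<delta>)"
  by (auto simp: cube_def mem_box_cart abs_le_iff) (smt (verit))+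

lemma is_tangent_cone_iff:
  "is_tangent_cone P v \<alpha> \<longleftrightarrow> local_arrangement \<alpha> \<and> (\<exists>\<delta>>0. \<forall>y\<in>cube \<delta>. v + y \<in> P \<longleftrightarrow> y \<in> \<alpha>)"
proof -
  have shift: "v + y \<in> (\<lambda>x. v + x) ` A \<longleftrightarrow> y \<in> A" for y A by auto
  have "P \<inter> (\<lambda>x. v + x) ` cube \<delta> = (\<lambda>x. v + x) ` (\<alpha> \<inter> cube \<delta>)
      \<longleftrightarrow> (\<forall>y\<in>cube \<delta>. v + y \<in> P \<longleftrightarrow> y \<in> \<alpha>)" (is "?A = ?B \<longleftrightarrow> _") for \<delta>
  proof -
    have "?A = ?B \<longleftrightarrow> (\<forall>y. v + y \<in> ?A \<longleftrightarrow> v + y \<in> ?B)"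
    proof
      assume R: "\<forall>y. v + y \<in> ?A \<longleftrightarrow> v + y \<in> ?B"
      show "?A = ?B"
      proof (rule Set.set_eqI)
        fix x show "x \<in> ?A \<longleftrightarrow> x \<in> ?B" using R[rule_format, of "x - v"] by simp
      qed
    qed simp
    also have "\<dots> \<longleftrightarrow> (\<forall>y\<in>cube \<delta>. v + y \<in> P \<longleftrightarrow> y \<in> \<alpha>)"
      unfolding shift Int_iff by blast
    finally show ?thesis .
  qed
  then show ?thesis by (simp add: is_tangent_cone_def)
qed

lemma local_arrangement_sgn:
  assumes "local_arrangement \<alpha>" "\<And>i. sgn (x $ i) = sgn (y $ i)"
  shows "x \<in> \<alpha> \<longleftrightarrow> y \<in> \<alpha>"
proof -
  have "0 \<le> s * x $ i \<longleftrightarrow> 0 \<le> s * y $ i" for s :: real and i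
    using assms(2)[of i] by (auto simp: sgn_if zero_le_mult_iff split: if_splits)
  then have "x \<in> orthant s \<longleftrightarrow> y \<in> orthant s" for s by (simp add: orthant_def)
  then show ?thesis using assms(1) by (auto simp: local_arrangement_def)
qed

lemma local_arrangement_scaleR:
  "\<lbrakk>local_arrangement \<alpha>; t > 0\<rbrakk> \<Longrightarrow> t *\<^sub>R x \<in> \<alpha> \<longleftrightarrow> x \<in> \<alpha>"
  by (rule local_arrangement_sgn) (auto simp: sgn_mult)

lemma local_arrangement_UN: "(\<And>i. i \<in> I \<Longrightarrow> local_arrangement (A i)) \<Longrightarrow> local_arrangement (\<Union>i\<in>I. A i)"
proof -
  assume "\<And>i. i \<in> I \<Longrightarrow> local_arrangement (A i)"
  then obtain S where S: "\<And>i. i \<in> I \<Longrightarrow> (\<forall>s\<in>S i. range s \<subseteq> {- 1, 1}) \<and> A i = (\<Union>s\<in>S i. orthant s)"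
    unfolding local_arrangement_def by metis
  have "(\<Union>i\<in>I. A i) = (\<Union>s\<in>(\<Union>i\<in>I. S i). orthant s)" using S by auto
  moreover have "\<forall>s\<in>(\<Union>i\<in>I. S i). range s \<subseteq> {- 1, 1}" using S by fast
  ultimately show ?thesis unfolding local_arrangement_def by metis
qed

text \<open>Two vectors share one factor because cones are compared at two points that must keep
  equal coordinates off one axis.\<close>

lemma shrink_into_cube:
  fixes x y :: "real^'n"
  assumes "\<delta> > 0"
  obtains t where "t > 0" "t *\<^sub>R x \<in> cube \<delta>" "t *\<^sub>R y \<in> cube \<delta>"
proof
  define M where "M = norm x + norm y + 1"
  have M: "M > 0" "norm x \<le> M" "norm y \<le> M" by (auto simp: M_def add_nonneg_pos)
  show "\<delta> / M > 0" using M assms by simp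
  have "\<bar>z $ i\<bar> \<le> M" if "norm z \<le> M" for z :: "real^'n" and i
    using component_le_norm_cart[of z i] that by linarith
  then have "(\<delta> / M) *\<^sub>R z \<in> cube \<delta>" if "norm z \<le> M" for z :: "real^'n"
    using M assms that by (auto simp: mem_cube abs_mult field_simps)
  then show "(\<delta> / M) *\<^sub>R x \<in> cube \<delta>" "(\<delta> / M) *\<^sub>R y \<in> cube \<delta>" using M by auto
qed

text \<open>Both cones agree with \<open>P\<close> on a common small cube, and scaling spreads the
  agreement everywhere.\<close>

lemma is_tangent_cone_unique:
  assumes "is_tangent_cone P v \<alpha>" "is_tangent_cone P v \<beta>"
  shows "\<alpha> = \<beta>"
proof -
  obtain d e where d: "d > 0" "\<forall>y\<in>cube d. v + y \<in> P \<longleftrightarrow> y \<in> \<alpha>" and e: "e > 0" "\<forall>y\<in>cube e. v + y \<in> P \<longleftrightarrow> y \<in> \<beta>"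
    using assms by (auto simp: is_tangent_cone_iff)
  have la: "local_arrangement \<alpha>" "local_arrangement \<beta>" using assms by (auto simp: is_tangent_cone_iff)
  have "x \<in> \<alpha> \<longleftrightarrow> x \<in> \<beta>" for x
  proof -
    obtain t where t: "t > 0" "t *\<^sub>R x \<in> cube (min d e)"
      using shrink_into_cube[of "min d e" x x] d e by auto
    then have "t *\<^sub>R x \<in> cube d" "t *\<^sub>R x \<in> cube e" by (auto simp: mem_cube)
    then have "t *\<^sub>R x \<in> \<alpha> \<longleftrightarrow> t *\<^sub>R x \<in> \<beta>" using d e by blast
    then show ?thesis using la t by (simp add: local_arrangement_scaleR)
  qed
  then show ?thesis by blast
qed

lemma tangent_cone_eq: "is_tangent_cone P v \<alpha> \<Longrightarrow> tangent_cone P v = \<alpha>"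
  unfolding tangent_cone_def using is_tangent_cone_unique by (intro the_equality) auto

lemma mem_tangent_cone_zero: "is_tangent_cone P v \<alpha> \<Longrightarrow> v \<in> P \<longleftrightarrow> 0 \<in> \<alpha>"
  unfolding is_tangent_cone_iff using add_0_right[of v] by (force simp: mem_cube)

text \<open>Strictness matters: at a point of a degenerate box the cone would be confined to 0 along
  some axis, and no orthant fits into that.\<close>

lemma local_arrangement_box_cone:
  assumes "\<And>i. a $ i < b $ i"
  shows "local_arrangement (box_cone a b v)"
proof -
  define S where "S = {s. range s \<subseteq> {- 1, 1} \<and> orthant s \<subseteq> box_cone a b v}"
  have "x \<in> (\<Union>s\<in>S. orthant s)" if x: "x \<in> box_cone a b v" for x
  proof -
    \<comment> \<open>An orthant through \<open>x\<close> inside the cone: the sign of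
      \<open>x\<close> where nonzero, elsewhere the side pointing into the box, which is negative at
      an upper end.\<close>
    define s :: "'a \<Rightarrow> real" where
      "s i = (if x $ i > 0 then 1 else if x $ i < 0 then - 1 else if v $ i = b $ i then - 1 else 1)" for i
    have "y \<in> box_cone a b v" if y: "y \<in> orthant s" for y
      unfolding box_cone_def
    proof (intro CollectI allI)
      fix i
      have "0 \<le> s i * y $ i" "in_interval_cone (a $ i) (b $ i) (v $ i) (x $ i)"
        using x y by (auto simp: box_cone_def orthant_def)
      then show "in_interval_cone (a $ i) (b $ i) (v $ i) (y $ i)"
        using assms[of i] by (auto simp: in_interval_cone_def s_def split: if_splits)
    qed
    then have "s \<in> S" by (auto simp: S_def s_def)
    moreover have "x \<in> orthant s" by (auto simp: orthant_def s_def)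
    ultimately show ?thesis by blast
  qed
  then have "box_cone a b v = (\<Union>s\<in>S. orthant s)" by (auto simp: S_def)
  then show ?thesis unfolding local_arrangement_def by (intro exI[of _ S]) (auto simp: S_def)
qed

text \<open>The two bounds are localized separately; away from a bound, half the distance to it is a
  safe radius.\<close>

lemma interval_cone_local:
  "\<exists>\<delta>>0. \<forall>s. \<bar>s\<bar> \<le> \<delta> \<longrightarrow> (a \<le> t + s \<and> t + s \<le> b \<longleftrightarrow> in_interval_cone a b t s)"
proof -
  have lower: "\<exists>\<delta>>0. \<forall>s. \<bar>s\<bar> \<le> \<delta> \<longrightarrow> (a \<le> t + s \<longleftrightarrow> a \<le> t \<and> (t = a \<longrightarrow> 0 \<le> s))"
  proof (cases "t = a")
    case True
    then show ?thesis by (intro exI[of _ 1]) auto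
  next
    case False
    then show ?thesis by (intro exI[of _ "\<bar>t - a\<bar> / 2"]) (auto simp: abs_if split: if_splits)
  qed
  have upper: "\<exists>\<delta>>0. \<forall>s. \<bar>s\<bar> \<le> \<delta> \<longrightarrow> (t + s \<le> b \<longleftrightarrow> t \<le> b \<and> (t = b \<longrightarrow> s \<le> 0))"
  proof (cases "t = b")
    case True
    then show ?thesis by (intro exI[of _ 1]) auto
  next
    case False
    then show ?thesis by (intro exI[of _ "\<bar>t - b\<bar> / 2"]) (auto simp: abs_if split: if_splits)
  qed
  obtain d e where "d > 0" "\<forall>s. \<bar>s\<bar> \<le> d \<longrightarrow> (a \<le> t + s \<longleftrightarrow> a \<le> t \<and> (t = a \<longrightarrow> 0 \<le> s))"
    "e > 0" "\<forall>s. \<bar>s\<bar> \<le> e \<longrightarrow> (t + s \<le> b \<longleftrightarrow> t \<le> b \<and> (t = b \<longrightarrow> s \<le> 0))"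
    using lower upper by blast
  then show ?thesis
    unfolding in_interval_cone_def by (intro exI[of _ "min d e"] conjI allI impI) (simp, auto)
qed

lemma finite_uniform_radius:
  fixes Q :: "'i \<Rightarrow> real \<Rightarrow> bool"
  assumes "finite I" "\<And>i. i \<in> I \<Longrightarrow> \<exists>\<delta>>0. \<forall>s. \<bar>s\<bar> \<le> \<delta> \<longrightarrow> Q i s"
  shows "\<exists>\<delta>>0. \<forall>i\<in>I. \<forall>s. \<bar>s\<bar> \<le> \<delta> \<longrightarrow> Q i s"
  using assms
proof (induction I rule: finite_induct)
  case empty
  then show ?case by (intro exI[of _ 1]) auto
next
  case (insert j I)
  then obtain d e where "d > 0" "\<forall>i\<in>I. \<forall>s. \<bar>s\<bar> \<le> d \<longrightarrow> Q i s" "e > 0" "\<forall>s. \<bar>s\<bar> \<le> e \<longrightarrow> Q j s"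
    by blast
  then show ?case by (intro exI[of _ "min d e"]) auto
qed

lemma is_tangent_cone_boxes:
  fixes ps :: "((real^'n) \<times> (real^'n)) set"
  assumes "finite ps" "\<And>p i. p \<in> ps \<Longrightarrow> fst p $ i < snd p $ i"
  shows "is_tangent_cone (\<Union>p\<in>ps. cbox (fst p) (snd p)) v (\<Union>p\<in>ps. box_cone (fst p) (snd p) v)"
proof -
  obtain \<delta> where \<delta>: "\<delta> > 0" "\<forall>(p, i)\<in>ps \<times> (UNIV :: 'n set). \<forall>s. \<bar>s\<bar> \<le> \<delta> \<longrightarrow>
      (fst p $ i \<le> v $ i + s \<and> v $ i + s \<le> snd p $ i \<longleftrightarrow> in_interval_cone (fst p $ i) (snd p $ i) (v $ i) s)"
    using finite_uniform_radius[of "ps \<times> (UNIV :: 'n set)" "\<lambda>(p, i) s.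
      (fst p $ i \<le> v $ i + s \<and> v $ i + s \<le> snd p $ i \<longleftrightarrow> in_interval_cone (fst p $ i) (snd p $ i) (v $ i) s)"]
      assms(1) interval_cone_local by (fastforce simp: case_prod_unfold)
  have "v + y \<in> cbox (fst p) (snd p) \<longleftrightarrow> y \<in> box_cone (fst p) (snd p) v" if "p \<in> ps" "y \<in> cube \<delta>" for p y
    using that \<delta>(2) by (simp add: mem_box_cart box_cone_def mem_cube)
  then have "\<forall>y\<in>cube \<delta>. v + y \<in> (\<Union>p\<in>ps. cbox (fst p) (snd p)) \<longleftrightarrow> y \<in> (\<Union>p\<in>ps. box_cone (fst p) (snd p) v)"
    by auto
  moreover have "local_arrangement (\<Union>p\<in>ps. box_cone (fst p) (snd p) v)"
    using assms by (intro local_arrangement_UN local_arrangement_box_cone) auto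
  ultimately show ?thesis using \<delta>(1) unfolding is_tangent_cone_iff by blast
qed

section \<open>Vertices\<close>

lemma congruent_arrangements_refl: "congruent_arrangements \<alpha> \<alpha>"
  unfolding congruent_arrangements_def
  by (rule exI[of _ id], rule exI[of _ "\<lambda>_. 1"]) (simp add: image_subset_iff)

text \<open>A signed permutation takes axes to axes, so a free axis \<open>i\<close> of
  \<open>\<beta>\<close> comes from the free axis \<open>\<pi> i\<close> of
  \<open>\<alpha>\<close>.\<close>

lemma congruent_cylinder:
  assumes "congruent_arrangements \<alpha> \<beta>" "cylinder i \<beta>"
  shows "\<exists>k. cylinder k \<alpha>"
proof -
  obtain \<pi> s where ps: "bij \<pi>" "range s \<subseteq> {- 1, 1 :: real}" "\<beta> = (\<lambda>x. \<chi> i. s i * x $ \<pi> i) ` \<alpha>"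
    using assms(1) unfolding congruent_arrangements_def by blast
  define g where "g x = (\<chi> i. s i * x $ \<pi> i)" for x
  have s0: "s i \<noteq> 0" for i
  proof -
    have "s i \<in> {- 1, 1}" using ps(2) by blast
    then show ?thesis by auto
  qed
  have inj: "x = y" if "g x = g y" for x y
  proof -
    have "x $ \<pi> i = y $ \<pi> i" for i using that s0[of i] by (auto simp: g_def vec_eq_iff)
    moreover have "\<exists>i. k = \<pi> i" for k using ps(1) by (auto simp: bij_def surj_def)
    ultimately show ?thesis unfolding vec_eq_iff by metis
  qed
  have "y \<in> \<alpha>" if "\<And>j. j \<noteq> \<pi> i \<Longrightarrow> x $ j = y $ j" "x \<in> \<alpha>" for x y
  proof -
    have "g x \<in> \<beta>" using that ps by (auto simp: g_def)
    moreover have "g x $ j = g y $ j" if "j \<noteq> i" for j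
      using \<open>\<And>j. j \<noteq> \<pi> i \<Longrightarrow> x $ j = y $ j\<close> ps(1) that by (auto simp: g_def bij_def dest: injD)
    ultimately have "g y \<in> \<beta>" using cylinderD[OF assms(2)] by metis
    then show ?thesis using inj ps(3) by (auto simp: g_def[symmetric])
  qed
  then have "cylinder (\<pi> i) \<alpha>" unfolding cylinder_def by blast
  then show ?thesis by blast
qed

lemma region_degree_zero:
  assumes "region_degree R = 0"
  shows "\<exists>a. R \<subseteq> {a :: real^'n}"
proof -
  let ?Q = "\<lambda>k. \<exists>I c. R \<subseteq> coord_flat I c \<and> aff_dim (coord_flat I c) = int k"
  have "coord_flat {} c = (UNIV :: (real^'n) set)" for c by (simp add: coord_flat_def)
  \<comment> \<open>\<open>LEAST\<close> needs a witness: the flat without constraints is the whole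
    space.\<close>
  then have "?Q (DIM(real^'n))" by (intro exI[of _ "{}"]) auto
  then have "?Q (region_degree R)" unfolding region_degree_def by (rule LeastI)
  then show ?thesis using assms by (auto simp: aff_dim_eq_0)
qed

lemma region_degree_singleton: "region_degree {v :: real^'n} = 0"
proof -
  have "coord_flat UNIV (($) v) = {v}" by (auto simp: coord_flat_def vec_eq_iff)
  then show ?thesis unfolding region_degree_def by (intro Least_eq_0) (metis aff_dim_sing of_nat_0 subset_refl)
qed

lemma is_tangent_cone_translate:
  assumes "is_tangent_cone P v \<alpha>" "cylinder i \<alpha>"
  shows "\<exists>\<delta>>0. \<forall>s. \<bar>s\<bar> \<le> \<delta> \<longrightarrow> is_tangent_cone P (v + axis i s) \<alpha>"
proof -
  obtain \<delta> where \<delta>: "\<delta> > 0" "\<forall>y\<in>cube \<delta>. v + y \<in> P \<longleftrightarrow> y \<in> \<alpha>"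
    using assms by (auto simp: is_tangent_cone_iff)
  \<comment> \<open>Half of the radius is spent on the shift, the other half on the cube around the
    new point.\<close>
  have "is_tangent_cone P (v + axis i s) \<alpha>" if s: "\<bar>s\<bar> \<le> \<delta> / 2" for s
    unfolding is_tangent_cone_iff
  proof (intro conjI exI ballI)
    show "local_arrangement \<alpha>" using assms by (simp add: is_tangent_cone_iff)
    show "\<delta> / 2 > 0" using \<delta> by simp
    fix y :: "real^'a" assume "y \<in> cube (\<delta> / 2)"
    then have y: "\<bar>y $ j\<bar> \<le> \<delta> / 2" for j by (auto simp: mem_cube)
    have "axis i s + y \<in> cube \<delta>"
      unfolding mem_cube
    proof
      fix j show "\<bar>(axis i s + y) $ j\<bar> \<le> \<delta>"
        using y[of j] s abs_triangle_ineq[of s "y $ j"] \<delta>(1) by (auto simp: axis_def)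
    qed
    then have "v + axis i s + y \<in> P \<longleftrightarrow> axis i s + y \<in> \<alpha>" using \<delta>(2) by (simp add: add.assoc)
    also have "\<dots> \<longleftrightarrow> y \<in> \<alpha>" by (rule cylinderD[OF assms(2)]) (simp add: axis_def)
    finally show "v + axis i s + y \<in> P \<longleftrightarrow> y \<in> \<alpha>" .
  qed
  then show ?thesis using \<delta>(1) by (intro exI[of _ "\<delta> / 2"]) auto
qed

text \<open>Moving along the free axis keeps the tangent cone, so a segment of positive length lies
  in the genericity region, and no flat of dimension 0 contains it.\<close>

lemma cylinder_not_vertex:
  fixes P :: "(real^'n) set"
  assumes t: "is_tangent_cone P v \<alpha>" and c: "cylinder i \<alpha>"
  shows "v \<notin> orthotope_vertices P"
proof
  assume "v \<in> orthotope_vertices P"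
  then have v: "v \<in> P" "region_degree (genericity_region P v) = 0" by (auto simp: orthotope_vertices_def)
  obtain \<delta> where \<delta>: "\<delta> > 0" "\<And>s. \<bar>s\<bar> \<le> \<delta> \<Longrightarrow> is_tangent_cone P (v + axis i s) \<alpha>"
    using is_tangent_cone_translate[OF t c] by blast
  let ?S = "{x \<in> P. congruent_arrangements (tangent_cone P v) (tangent_cone P x)}"
  have 0: "0 \<in> \<alpha>" using mem_tangent_cone_zero[OF t] v by simp
  have "closed_segment v (v + axis i \<delta>) \<subseteq> ?S"
  proof
    fix x assume "x \<in> closed_segment v (v + axis i \<delta>)"
    then obtain u where u: "0 \<le> u" "u \<le> 1" "x = (1 - u) *\<^sub>R v + u *\<^sub>R (v + axis i \<delta>)"
      by (auto simp: closed_segment_def)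
    have x: "x = v + axis i (u * \<delta>)"
      unfolding u(3) by (simp add: vec_eq_iff axis_def algebra_simps)
    have "\<bar>u * \<delta>\<bar> \<le> \<delta>" using u \<delta>(1) by (simp add: abs_mult mult_left_le_one_le)
    then have tx: "is_tangent_cone P x \<alpha>" using \<delta>(2) x by simp
    then have "x \<in> P" using mem_tangent_cone_zero[OF tx] 0 by simp
    then show "x \<in> ?S" by (simp add: tangent_cone_eq[OF tx] tangent_cone_eq[OF t] congruent_arrangements_refl)
  qed
  then have "closed_segment v (v + axis i \<delta>) \<subseteq> genericity_region P v"
    unfolding genericity_region_def
    by (intro path_component_maximal convex_imp_path_connected) auto
  moreover obtain a where "genericity_region P v \<subseteq> {a}" using region_degree_zero[OF v(2)] by blast
  ultimately have "v = a" "v + axis i \<delta> = a" by (auto dest: subsetD)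
  then have "axis i \<delta> = 0" by simp
  then show False using \<delta>(1) by (simp add: axis_eq_0_iff)
qed

text \<open>
  Near \<open>v\<close>, the arrangement seen from \<open>v + w\<close> does not change along any axis in which \<open>w\<close> has a
  nonzero component.
\<close>

lemma nearby_tangent_cone_cylinder:
  assumes t: "local_arrangement \<alpha>" "\<forall>y\<in>cube \<delta>. v + y \<in> P \<longleftrightarrow> y \<in> \<alpha>"
    and w: "\<And>j. \<bar>w $ j\<bar> < \<delta>" "w $ i \<noteq> 0" and tb: "is_tangent_cone P (v + w) \<beta>"
  shows "cylinder i \<beta>"
proof -
  obtain e where e: "e > 0" "\<forall>y\<in>cube e. v + w + y \<in> P \<longleftrightarrow> y \<in> \<beta>" and lb: "local_arrangement \<beta>"
    using tb by (auto simp: is_tangent_cone_iff)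
  obtain d where d: "d > 0" "\<And>j. \<bar>w $ j\<bar> + d \<le> \<delta>"
  proof -
    have "Min (range (\<lambda>j. \<delta> - \<bar>w $ j\<bar>)) > 0" using w(1) by (subst Min_gr_iff) auto
    moreover have "\<bar>w $ j\<bar> + Min (range (\<lambda>j. \<delta> - \<bar>w $ j\<bar>)) \<le> \<delta>" for j
    proof -
      have "Min (range (\<lambda>j. \<delta> - \<bar>w $ j\<bar>)) \<le> \<delta> - \<bar>w $ j\<bar>" by (rule Min_le) auto
      then show ?thesis by linarith
    qed
    ultimately show thesis using that by blast
  qed
  \<comment> \<open>Below \<open>d\<close> the sum \<open>w + y\<close> stays in the cube around
    \<open>v\<close>, below \<open>e\<close> the cone \<open>\<beta>\<close> describes
    \<open>P\<close>, and below \<open>\<bar>w $ i\<bar>\<close> the sign of coordinate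
    \<open>i\<close> is that of \<open>w\<close>.\<close>
  define r where "r = Min {d, e, \<bar>w $ i\<bar> / 2}"
  have r: "r > 0" "r \<le> d" "r \<le> e" "r < \<bar>w $ i\<bar>" using d(1) e(1) w(2) by (auto simp: r_def min_def)
  have local: "y \<in> \<beta> \<longleftrightarrow> w + y \<in> \<alpha>" if "y \<in> cube r" for y
  proof -
    have y: "\<bar>y $ j\<bar> \<le> r" for j using that by (auto simp: mem_cube)
    have "y \<in> cube e" using y r by (auto simp: mem_cube intro: order_trans)
    moreover have "w + y \<in> cube \<delta>"
      unfolding mem_cube
    proof
      fix j show "\<bar>(w + y) $ j\<bar> \<le> \<delta>"
        using y[of j] d(2)[of j] r abs_triangle_ineq[of "w $ j" "y $ j"] by simp
    qed
    ultimately show ?thesis using e(2) t(2) by (metis add.assoc)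
  qed
  have "y \<in> \<beta>" if "\<And>j. j \<noteq> i \<Longrightarrow> x $ j = y $ j" "x \<in> \<beta>" for x y
  proof -
    obtain c where c: "c > 0" "c *\<^sub>R x \<in> cube r" "c *\<^sub>R y \<in> cube r" using shrink_into_cube[OF r(1)] .
    \<comment> \<open>Coordinate \<open>i\<close> is dominated by \<open>w\<close>; in the others
      the two points coincide.\<close>
    have "sgn ((w + c *\<^sub>R x) $ j) = sgn ((w + c *\<^sub>R y) $ j)" for j
    proof (cases "j = i")
      case True
      have "\<bar>c * x $ i\<bar> \<le> r" "\<bar>c * y $ i\<bar> \<le> r" using c by (auto simp: mem_cube)
      then show ?thesis using r True by (auto simp: sgn_if)
    qed (use that in auto)
    then have "w + c *\<^sub>R x \<in> \<alpha> \<longleftrightarrow> w + c *\<^sub>R y \<in> \<alpha>" by (rule local_arrangement_sgn[OF t(1)])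
    then show ?thesis using local[OF c(2)] local[OF c(3)] that(2) c(1) lb by (simp add: local_arrangement_scaleR)
  qed
  then show ?thesis unfolding cylinder_def by blast
qed

text \<open>Every other point of \<open>P\<close> near \<open>v\<close> differs from it in some
  coordinate, so its cone has a free axis and is not congruent to \<open>\<alpha> v\<close>. Hence
  \<open>v\<close> is isolated among the points with congruent cone, and its path component is a
  single point.\<close>

lemma not_cylinder_vertex:
  fixes P :: "(real^'n) set"
  assumes v: "v \<in> P" and t: "\<And>x. x \<in> P \<Longrightarrow> is_tangent_cone P x (\<alpha> x)"
    and nc: "\<And>i. \<not> cylinder i (\<alpha> v)"
  shows "v \<in> orthotope_vertices P"
proof -
  let ?S = "{x \<in> P. congruent_arrangements (tangent_cone P v) (tangent_cone P x)}"
  obtain \<delta> where \<delta>: "\<delta> > 0" "\<forall>y\<in>cube \<delta>. v + y \<in> P \<longleftrightarrow> y \<in> \<alpha> v" and la: "local_arrangement (\<alpha> v)"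
    using t[OF v] by (auto simp: is_tangent_cone_iff)
  have isolated: "x = v" if x: "x \<in> ?S" "x \<in> ball v \<delta>" for x
  proof (rule ccontr)
    assume "x \<noteq> v"
    then obtain i where i: "(x - v) $ i \<noteq> 0" by (auto simp: vec_eq_iff)
    have "\<bar>(x - v) $ j\<bar> < \<delta>" for j
      using component_le_norm_cart[of "x - v" j] x(2) by (simp add: dist_norm norm_minus_commute)
    then have "cylinder i (\<alpha> x)"
      using nearby_tangent_cone_cylinder[OF la \<delta>(2), of "x - v" i "\<alpha> x"] i t[of x] x(1) by auto
    moreover have "congruent_arrangements (\<alpha> v) (\<alpha> x)"
      using x(1) tangent_cone_eq[OF t[OF v]] tangent_cone_eq[OF t[of x]] by simp
    ultimately show False using congruent_cylinder nc by blast
  qed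
  have vS: "v \<in> ?S" using v by (simp add: congruent_arrangements_refl)
  have "genericity_region P v = {v}"
  proof -
    let ?T = "path_component_set ?S v"
    have vT: "v \<in> ?T" using vS by (simp add: path_component_refl)
    have TS: "?T \<subseteq> ?S" by (rule path_component_subset)
    have "connected ?T" by (rule path_connected_imp_connected[OF path_connected_path_component])
    moreover have "openin (top_of_set ?T) {v}"
    proof -
      have "{v} = ?T \<inter> ball v \<delta>" using isolated TS vT \<delta>(1) by auto
      then show ?thesis by (metis openin_open_Int open_ball)
    qed
    moreover have "closedin (top_of_set ?T) {v}" using vT by (simp add: closed_subset)
    ultimately have "?T = {v}" unfolding connected_clopen by blast
    then show ?thesis by (simp add: genericity_region_def)
  qed
  then show ?thesis using v by (simp add: orthotope_vertices_def region_degree_singleton)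
qed

text \<open>When coordinate \<open>i\<close> of \<open>v\<close> avoids all ends, the end conditions
  are vacuous on that axis.\<close>

lemma box_cones_cylinder:
  assumes "\<And>p. p \<in> ps \<Longrightarrow> v $ i \<noteq> fst p $ i \<and> v $ i \<noteq> snd p $ i"
  shows "cylinder i (\<Union>p\<in>ps. box_cone (fst p) (snd p) v)"
  unfolding cylinder_def
proof (intro allI impI)
  fix x y assume xy: "\<forall>j. j \<noteq> i \<longrightarrow> x $ j = y $ j" and "x \<in> (\<Union>p\<in>ps. box_cone (fst p) (snd p) v)"
  then obtain p where p: "p \<in> ps" and x: "\<And>j. in_interval_cone (fst p $ j) (snd p $ j) (v $ j) (x $ j)"
    by (auto simp: box_cone_def)
  have "in_interval_cone (fst p $ j) (snd p $ j) (v $ j) (y $ j)" for j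
    using x[of j] xy assms[OF p] by (cases "j = i") (auto simp: in_interval_cone_def)
  then show "y \<in> (\<Union>p\<in>ps. box_cone (fst p) (snd p) v)" using p by (auto simp: box_cone_def)
qed

section \<open>The vertex formula\<close>

theorem theorem4p9:
  fixes P :: "(real ^ 'n) set"
  assumes "generic_orthotope P"
  shows "real_of_int (euler_characteristic (top_of_set P)) =
           (1 / 2) ^ CARD('n) * real_of_int (orthotope_sign P)"
proof -
  obtain \<B> where \<B>: "finite \<B>" "\<forall>B\<in>\<B>. \<exists>a b. (\<forall>i. a $ i < b $ i) \<and> B = cbox a b" "P = \<Union>\<B>"
    using assms by (auto simp: generic_orthotope_def orthogonal_polytope_def)
  obtain f :: "(real^'n) set \<Rightarrow> (real^'n) \<times> (real^'n)" where
    f: "\<And>B. B \<in> \<B> \<Longrightarrow> (\<forall>i. fst (f B) $ i < snd (f B) $ i) \<and> B = cbox (fst (f B)) (snd (f B))"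
  proof -
    have "\<forall>B\<in>\<B>. \<exists>p. (\<forall>i. fst p $ i < snd p $ i) \<and> B = cbox (fst p) (snd p)" using \<B>(2) by (metis fst_conv snd_conv)
    then show thesis using that by metis
  qed
  define ps where "ps = f ` \<B>"
  have fin: "finite ps" and lt: "\<And>p i. p \<in> ps \<Longrightarrow> fst p $ i < snd p $ i" using \<B>(1) f by (auto simp: ps_def)
  have P: "P = (\<Union>p\<in>ps. cbox (fst p) (snd p))" using f \<B>(3) by (auto simp: ps_def)
  \<comment> \<open>One finite set of values serves all axes; the additional grid points this
    creates are either vertices or of weight 0.\<close>
  define G where "G = (\<Union>p\<in>ps. range (($) (fst p)) \<union> range (($) (snd p)))"
  have G: "finite G" using fin by (simp add: G_def)
  have grid: "\<forall>p\<in>ps. fst p \<in> grid G \<and> snd p \<in> grid G" by (auto simp: grid_def G_def)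
  define \<alpha> where "\<alpha> v = (\<Union>p\<in>ps. box_cone (fst p) (snd p) v)" for v
  have t: "is_tangent_cone P v (\<alpha> v)" for v
    unfolding P \<alpha>_def by (rule is_tangent_cone_boxes[OF fin lt])
  have sub: "orthotope_vertices P \<subseteq> grid G"
  proof
    fix v assume v: "v \<in> orthotope_vertices P"
    show "v \<in> grid G"
    proof (rule ccontr)
      assume "v \<notin> grid G"
      then obtain i where "v $ i \<notin> G" by (auto simp: grid_def)
      then have "cylinder i (\<alpha> v)" unfolding \<alpha>_def by (intro box_cones_cylinder) (auto simp: G_def)
      then show False using cylinder_not_vertex[OF t] v by blast
    qed
  qed
  \<comment> \<open>A point of \<open>P\<close> that is not a vertex has a cone with a free axis; a
    point outside \<open>P\<close> has the empty cone.\<close>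
  have zero: "cone_weight (\<alpha> v) = 0" if "v \<notin> orthotope_vertices P" for v
  proof (cases "v \<in> P")
    case True
    have "\<exists>i. cylinder i (\<alpha> v)"
    proof (rule ccontr)
      assume "\<not> ?thesis"
      then have "v \<in> orthotope_vertices P" by (intro not_cylinder_vertex[OF True t]) auto
      then show False using that by contradiction
    qed
    then obtain i where "cylinder i (\<alpha> v)" by blast
    then show ?thesis by (rule cone_weight_cylinder)
  next
    case False
    then have "\<alpha> v = {}" unfolding P \<alpha>_def by (auto simp: box_cone_def in_interval_cone_def mem_box_cart)
    then show ?thesis by simp
  qed
  have "2 ^ CARD('n) * euler_characteristic (top_of_set P) = (\<Sum>v\<in>grid G. cone_weight (\<alpha> v))"
    unfolding P \<alpha>_def by (rule euler_characteristic_boxes[OF G fin grid])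
  also have "\<dots> = (\<Sum>v\<in>orthotope_vertices P. cone_weight (\<alpha> v))"
    using sub zero finite_grid[OF G] by (intro sum.mono_neutral_right) auto
  also have "\<dots> = orthotope_sign P"
    unfolding orthotope_sign_def
  proof (rule sum.cong)
    fix v assume "v \<in> orthotope_vertices P"
    then have "floral_vertex (\<alpha> v)"
      using assms by (metis generic_orthotope_def tangent_cone_eq[OF t])
    then show "cone_weight (\<alpha> v) = floral_sign (tangent_cone P v)"
      by (simp add: floral_sign_eq_cone_weight tangent_cone_eq[OF t])
  qed simp
  finally have "2 ^ CARD('n) * real_of_int (euler_characteristic (top_of_set P)) = real_of_int (orthotope_sign P)"
    by (metis of_int_mult of_int_numeral of_int_power)
  then show ?thesis by (simp add: field_simps power_one_over)
qed

end
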